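(* Let $d=3$, $m=1$, and $A=B=e_1\in\mathbb R^3$. The action fiber $\{P\in\mathscr P_3:Pe_1=e_1\}$ equals $$\{\operatorname{diag}(1,\Sigma):\Sigma\in\mathscr P_2\},$$ its canonical controller is $I_3$, and for every $D>0$ there are a point $P$ of the fiber with $d_{\mathrm{AI}}(I,P)=D$ and a unit tangent vector $v$ to the fiber at $P$ such that $$\operatorname{Hess}F_B(v,v)=\psi(D/\sqrt2).$$ Hence $\psi(D/\sqrt2)$ is the sharp dimension-uniform radius-only Hessian majorant within the action family: for all $1\le m<d$, full-column-rank $A\in\mathbb R^{d\times m}$ and $B\in\mathscr B_A$, one has $\operatorname{Hess}F_B(P)\preceq\psi(D/\sqrt2)g_P$ at every fiber point with $d_{\mathrm{AI}}(I,P)\le D$, and no smaller constant depending only on $D$ has this property. Moreover, for $A=B=e_1$ in $\mathbb R^3$, along a radial geodesic in the fiber (issuing from the canonical controller) both posterior inequalities $$d_{\mathrm{AI}}(\Phi_A(B,\Sigma),s_A(B))\le\|W_B(\Sigma)\|_F,\qquad f_B(\Sigma)-f_B(\Sigma_\star)\le\tfrac12\|W_B(\Sigma)\|_F^2$$ hold with equality.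
   Context: $\psi(s)=s\coth s$ for $s>0$, $\psi(0)=1$. $\mathbb S_{++}^d$ denotes real symmetric positive definite matrices with affine-invariant metric $g$: $\langle X,Y\rangle_P=\operatorname{tr}(P^{-1}XP^{-1}Y)$, and distance $d_{\mathrm{AI}}(P,P')=\|\log(P^{-1/2}P'P^{-1/2})\|_F$; $\mathscr P_d=\{P\in\mathbb S_{++}^d:\det P=1\}$. $\mathscr B_A=\{B\in\mathbb R^{d\times m}:A^\top B\in\mathbb S_{++}^m\}$. The action fiber is $\mathscr F_A(B)=\{P\in\mathscr P_d:PA=B\}$ (a totally geodesic submanifold) and $F_B(P)=\tfrac12d_{\mathrm{AI}}(I,P)^2$ is the fiber objective, with Hessian taken on the fiber in the induced metric. The canonical controller $s_A(B)$ is the unique minimizer of $F_B$ on the fiber. Fix $A=UC$ with $U^\top U=I_m$, $C$ invertible, $Q=[U,V]\in O(d)$, $n=d-m$. Let $M=C^{-\top}A^\top BC^{-1}$, $N=V^\top BC^{-1}$, $T=NM^{-1}$, $L=\begin{pmatrix}I_m&0\\ T&I_n\end{pmatrix}$, $\rho=(\det M)^{-1/n}$, $\mathcal Q_\Sigma=\operatorname{diag}(M,\rho\Sigma)$, $\Phi_A(B,\Sigma)=QL\mathcal Q_\Sigma L^\top Q^\top$ for $\Sigma\in\mathscr P_n$, $R_0=L^{-1}L^{-\top}$, $f_B(\Sigma)=\tfrac12d_{\mathrm{AI}}(R_0,\mathcal Q_\Sigma)^2$, $\mathcal R(\Sigma)=\log(\mathcal Q_\Sigma^{-1/2}R_0\mathcal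 Q_\Sigma^{-1/2})$ with lower-right $n\times n$ block $\mathcal R_{22}$, $W_B(\Sigma)=\mathcal R_{22}(\Sigma)-\frac{\operatorname{tr}\mathcal R_{22}(\Sigma)}nI_n$, and $\Sigma_\star$ with $\Phi_A(B,\Sigma_\star)=s_A(B)$. *)

theory Defs
  imports "HOL-Analysis.Analysis"
begin

definition spd :: "(real^'d^'d) set" where
  "spd = {P. transpose P = P \<and> (\<forall>x. x \<noteq> 0 \<longrightarrow> x \<bullet> (P *v x) > 0)}"

definition spd1 :: "(real^'d^'d) set" where
  "spd1 = {P \<in> spd. det P = 1}"

definition mat_exp :: "real^'d^'d \<Rightarrow> real^'d^'d" where
  "mat_exp X = (\<Sum>k. (1 / fact k) *\<^sub>R (((**) X ^^ k) (mat 1)))"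

text \<open>Principal logarithm and principal square root; both are used on \<open>spd\<close> only, where they
  are uniquely determined.\<close>

definition mat_log :: "real^'d^'d \<Rightarrow> real^'d^'d" where
  "mat_log P = (THE X. transpose X = X \<and> mat_exp X = P)"

definition mat_sqrt :: "real^'d^'d \<Rightarrow> real^'d^'d" where
  "mat_sqrt P = (THE S. S \<in> spd \<and> S ** S = P)"

definition ai_metric :: "real^'d^'d \<Rightarrow> real^'d^'d \<Rightarrow> real^'d^'d \<Rightarrow> real" where
  "ai_metric P X Y = trace (matrix_inv P ** X ** matrix_inv P ** Y)"

text \<open>\<open>norm\<close> on \<open>real^'d^'d\<close> is the Euclidean norm of all entries, i.e. the Frobenius norm.
  \<open>ai_whiten P X\<close> is $P^{-1/2} X P^{-1/2}$.\<close>

definition ai_whiten :: "real^'d^'d \<Rightarrow> real^'d^'d \<Rightarrow> real^'d^'d" where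
  "ai_whiten P X = matrix_inv (mat_sqrt P) ** X ** matrix_inv (mat_sqrt P)"

definition ai_dist :: "real^'d^'d \<Rightarrow> real^'d^'d \<Rightarrow> real" where
  "ai_dist P R = norm (mat_log (ai_whiten P R))"

text \<open>Levi-Civita connection of the affine-invariant metric on \<open>spd\<close>, in the linear coordinates
  of the space of symmetric matrices:
  $\nabla_X Y = D_X Y - \frac12 (X P^{-1} Y + Y P^{-1} X)$ at the point $P$.
  The argument \<open>DY\<close> is the ordinary derivative of the vector field (or of the vector field along
  a curve) in the direction \<open>X\<close>. The correction term is symmetric in \<open>X\<close> and \<open>Y\<close>, and
  differentiating \<open>ai_metric\<close> along a curve shows that the connection is metric.\<close>

definition ai_covariant ::
    "real^'d^'d \<Rightarrow> real^'d^'d \<Rightarrow> real^'d^'d \<Rightarrow> real^'d^'d \<Rightarrow> real^'d^'d" where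
  "ai_covariant P X Y DY =
     DY - (1/2) *\<^sub>R (X ** matrix_inv P ** Y + Y ** matrix_inv P ** X)"

text \<open>\<open>N\<close> stands for a smooth submanifold of \<open>spd\<close>.
  \<open>curve_in N P v c\<close>: near time 0 the curve \<open>c\<close> runs in \<open>N\<close>, and at time 0 it passes through
  \<open>P\<close> with velocity \<open>v\<close>.\<close>

definition curve_in ::
    "(real^'d^'d) set \<Rightarrow> real^'d^'d \<Rightarrow> real^'d^'d \<Rightarrow> (real \<Rightarrow> real^'d^'d) \<Rightarrow> bool" where
  "curve_in N P v c \<longleftrightarrow>
     c 0 = P \<and> (\<forall>\<^sub>F t in nhds 0. c t \<in> N) \<and> (c has_vector_derivative v) (at 0)"

definition tangent_at :: "(real^'d^'d) set \<Rightarrow> real^'d^'d \<Rightarrow> (real^'d^'d) set" where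
  "tangent_at N P = {v. \<exists>c. curve_in N P v c}"

definition is_gradient ::
    "(real^'d^'d) set \<Rightarrow> (real^'d^'d \<Rightarrow> real) \<Rightarrow> real^'d^'d \<Rightarrow> real^'d^'d \<Rightarrow> bool" where
  "is_gradient N f P G \<longleftrightarrow>
     G \<in> tangent_at N P \<and>
     (\<forall>v c. curve_in N P v c \<longrightarrow>
        ((\<lambda>t. f (c t)) has_real_derivative ai_metric P G v) (at 0))"

text \<open>\<open>H\<close> is the Hessian at \<open>P\<close> of \<open>f\<close> restricted to \<open>N\<close>:
  $H(v,w) = \langle \nabla^N_v \mathrm{grad} f, w\rangle_P$ for tangent \<open>v\<close>, \<open>w\<close>.
  The connection $\nabla^N$ of the induced metric is the orthogonal projection of the ambient
  one to the tangent space; as \<open>w\<close> is tangent to \<open>N\<close>, the projection drops out of the inner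
  product. The values of \<open>H\<close> at nontangent arguments are unconstrained.\<close>

definition has_hessian ::
    "(real^'d^'d) set \<Rightarrow> (real^'d^'d \<Rightarrow> real) \<Rightarrow> real^'d^'d \<Rightarrow>
     (real^'d^'d \<Rightarrow> real^'d^'d \<Rightarrow> real) \<Rightarrow> bool" where
  "has_hessian N f P H \<longleftrightarrow>
     (\<exists>G. (\<forall>R\<in>N. is_gradient N f R (G R)) \<and>
          (\<forall>v c. curve_in N P v c \<longrightarrow>
             (\<exists>DG. ((\<lambda>t. G (c t)) has_vector_derivative DG) (at 0) \<and>
                   (\<forall>w\<in>tangent_at N P.
                      H v w = ai_metric P (ai_covariant P v (G P) DG) w))))"

text \<open>Complete geodesic of \<open>N\<close> in the induced metric with initial point \<open>S\<close> and initial
  velocity \<open>v\<close>: the ambient covariant acceleration has no tangential component.\<close>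

definition geodesic_from ::
    "(real^'d^'d) set \<Rightarrow> real^'d^'d \<Rightarrow> real^'d^'d \<Rightarrow> (real \<Rightarrow> real^'d^'d) \<Rightarrow> bool" where
  "geodesic_from N S v \<gamma> \<longleftrightarrow>
     \<gamma> 0 = S \<and> (\<forall>t. \<gamma> t \<in> N) \<and>
     (\<exists>\<gamma>' \<gamma>''. \<gamma>' 0 = v \<and>
        (\<forall>t. (\<gamma> has_vector_derivative \<gamma>' t) (at t) \<and>
             (\<gamma>' has_vector_derivative \<gamma>'' t) (at t) \<and>
             (\<forall>w\<in>tangent_at N (\<gamma> t).
                ai_metric (\<gamma> t) (ai_covariant (\<gamma> t) (\<gamma>' t) (\<gamma>' t) (\<gamma>'' t)) w = 0)))"

text \<open>$d \times m$ matrices have type \<open>real^'m^'d\<close>.\<close>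

definition admissible_targets :: "real^'m^'d \<Rightarrow> (real^'m^'d) set" where
  "admissible_targets A = {B. transpose A ** B \<in> spd}"

definition action_fiber :: "real^'m^'d \<Rightarrow> real^'m^'d \<Rightarrow> (real^'d^'d) set" where
  "action_fiber A B = {P \<in> spd1. P ** A = B}"

definition fiber_objective :: "real^'d^'d \<Rightarrow> real" where
  "fiber_objective P = (1/2) * (ai_dist (mat 1) P)\<^sup>2"

definition is_canonical_controller :: "real^'m^'d \<Rightarrow> real^'m^'d \<Rightarrow> real^'d^'d \<Rightarrow> bool" where
  "is_canonical_controller A B S \<longleftrightarrow>
     S \<in> action_fiber A B \<and>
     (\<forall>P\<in>action_fiber A B. P \<noteq> S \<longrightarrow> fiber_objective S < fiber_objective P)"

definition canonical_controller :: "real^'m^'d \<Rightarrow> real^'m^'d \<Rightarrow> real^'d^'d" where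
  "canonical_controller A B = (THE S. is_canonical_controller A B S)"

definition psi :: "real \<Rightarrow> real" where
  "psi s = (if s = 0 then 1 else s * (cosh s / sinh s))"

text \<open>\<open>hessian_majorant TYPE('d) TYPE('m) D c\<close>: on all fibers with $A, B \in \mathbb R^{d\times m}$
  the bound $\mathrm{Hess}\, F_B(P) \preceq c\, g_P$ holds at distance at most \<open>D\<close> from the
  identity.\<close>

definition hessian_majorant ::
    "'d::finite itself \<Rightarrow> 'm::finite itself \<Rightarrow> real \<Rightarrow> real \<Rightarrow> bool" where
  "hessian_majorant _ _ D c \<longleftrightarrow>
     (\<forall>(A :: real^'m^'d) B P.
        rank A = CARD('m) \<longrightarrow> B \<in> admissible_targets A \<longrightarrow>
        P \<in> action_fiber A B \<longrightarrow> ai_dist (mat 1) P \<le> D \<longrightarrow>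
        (\<exists>H. has_hessian (action_fiber A B) fiber_objective P H \<and>
             (\<forall>v\<in>tangent_at (action_fiber A B) P. H v v \<le> c * ai_metric P v v)))"

text \<open>Block matrices are indexed by the sum type \<open>'m + 'n\<close>. A matrix $Q = [U, V] \in O(d)$ with
  $d = m + n$ has type \<open>real^('m + 'n)^'d\<close>; the two orthogonality equations force
  \<open>CARD('d) = CARD('m) + CARD('n)\<close>.\<close>

definition block_mat ::
    "real^'m^'m \<Rightarrow> real^'n^'m \<Rightarrow> real^'m^'n \<Rightarrow> real^'n^'n \<Rightarrow> real^('m::finite + 'n::finite)^('m::finite + 'n::finite)" where
  "block_mat X Y Z W = (\<chi> i j. case i of
      Inl a \<Rightarrow> (case j of Inl b \<Rightarrow> X $ a $ b | Inr b \<Rightarrow> Y $ a $ b)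
    | Inr a \<Rightarrow> (case j of Inl b \<Rightarrow> Z $ a $ b | Inr b \<Rightarrow> W $ a $ b))"

definition left_columns :: "real^('m::finite + 'n::finite)^'d \<Rightarrow> real^'m^'d" where
  "left_columns Q = (\<chi> i j. Q $ i $ Inl j)"

definition right_columns :: "real^('m::finite + 'n::finite)^'d \<Rightarrow> real^'n^'d" where
  "right_columns Q = (\<chi> i j. Q $ i $ Inr j)"

definition lower_right :: "real^('m::finite + 'n::finite)^('m::finite + 'n::finite) \<Rightarrow> real^'n^'n" where
  "lower_right X = (\<chi> i j. X $ Inr i $ Inr j)"

definition fiber_frame :: "real^'m^'d \<Rightarrow> real^('m::finite + 'n::finite)^'d \<Rightarrow> real^'m^'m \<Rightarrow> bool" where
  "fiber_frame A Q C \<longleftrightarrow>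
     transpose Q ** Q = mat 1 \<and> Q ** transpose Q = mat 1 \<and>
     invertible C \<and> A = left_columns Q ** C"

definition fiber_M :: "real^'m^'d \<Rightarrow> real^'m^'m \<Rightarrow> real^'m^'d \<Rightarrow> real^'m^'m" where
  "fiber_M A C B = transpose (matrix_inv C) ** transpose A ** B ** matrix_inv C"

definition fiber_N :: "real^('m::finite + 'n::finite)^'d \<Rightarrow> real^'m^'m \<Rightarrow> real^'m^'d \<Rightarrow> real^'m^'n" where
  "fiber_N Q C B = transpose (right_columns Q) ** B ** matrix_inv C"

definition fiber_T ::
    "real^'m^'d \<Rightarrow> real^('m::finite + 'n::finite)^'d \<Rightarrow> real^'m^'m \<Rightarrow> real^'m^'d \<Rightarrow> real^'m^'n" where
  "fiber_T A Q C B = fiber_N Q C B ** matrix_inv (fiber_M A C B)"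

definition fiber_L ::
    "real^'m^'d \<Rightarrow> real^('m::finite + 'n::finite)^'d \<Rightarrow> real^'m^'m \<Rightarrow> real^'m^'d \<Rightarrow>
     real^('m::finite + 'n::finite)^('m::finite + 'n::finite)" where
  "fiber_L A Q C B = block_mat (mat 1) 0 (fiber_T A Q C B) (mat 1)"

definition fiber_core ::
    "real^'m^'d \<Rightarrow> real^'m^'m \<Rightarrow> real^'m^'d \<Rightarrow> real^'n^'n \<Rightarrow> real^('m::finite + 'n::finite)^('m::finite + 'n::finite)" where
  "fiber_core A C B \<Sigma> =
     block_mat (fiber_M A C B) 0 0 ((det (fiber_M A C B) powr (- 1 / real CARD('n))) *\<^sub>R \<Sigma>)"

definition fiber_Phi ::
    "real^'m^'d \<Rightarrow> real^('m::finite + 'n::finite)^'d \<Rightarrow> real^'m^'m \<Rightarrow> real^'m^'d \<Rightarrow> real^'n^'n \<Rightarrow>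
     real^'d^'d" where
  "fiber_Phi A Q C B \<Sigma> =
     Q ** fiber_L A Q C B ** fiber_core A C B \<Sigma> ** transpose (fiber_L A Q C B) ** transpose Q"

definition fiber_R0 ::
    "real^'m^'d \<Rightarrow> real^('m::finite + 'n::finite)^'d \<Rightarrow> real^'m^'m \<Rightarrow> real^'m^'d \<Rightarrow>
     real^('m::finite + 'n::finite)^('m::finite + 'n::finite)" where
  "fiber_R0 A Q C B = matrix_inv (fiber_L A Q C B) ** transpose (matrix_inv (fiber_L A Q C B))"

definition reduced_objective ::
    "real^'m^'d \<Rightarrow> real^('m::finite + 'n::finite)^'d \<Rightarrow> real^'m^'m \<Rightarrow> real^'m^'d \<Rightarrow> real^'n^'n \<Rightarrow> real" where
  "reduced_objective A Q C B \<Sigma> = (1/2) * (ai_dist (fiber_R0 A Q C B) (fiber_core A C B \<Sigma>))\<^sup>2"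

definition fiber_residual ::
    "real^'m^'d \<Rightarrow> real^('m::finite + 'n::finite)^'d \<Rightarrow> real^'m^'m \<Rightarrow> real^'m^'d \<Rightarrow> real^'n^'n \<Rightarrow>
     real^('m::finite + 'n::finite)^('m::finite + 'n::finite)" where
  "fiber_residual A Q C B \<Sigma> = mat_log (ai_whiten (fiber_core A C B \<Sigma>) (fiber_R0 A Q C B))"

definition fiber_W ::
    "real^'m^'d \<Rightarrow> real^('m::finite + 'n::finite)^'d \<Rightarrow> real^'m^'m \<Rightarrow> real^'m^'d \<Rightarrow> real^'n^'n \<Rightarrow>
     real^'n^'n" where
  "fiber_W A Q C B \<Sigma> =
     lower_right (fiber_residual A Q C B \<Sigma>) -
     mat (trace (lower_right (fiber_residual A Q C B \<Sigma>)) / real CARD('n))"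

definition e1 :: "real^1^3" where
  "e1 = columnvector (axis 1 1)"

definition diag1 :: "real^2^2 \<Rightarrow> real^3^3" where
  "diag1 \<Sigma> = vector [vector [1, 0, 0],
                     vector [0, \<Sigma> $ 1 $ 1, \<Sigma> $ 1 $ 2],
                     vector [0, \<Sigma> $ 2 $ 1, \<Sigma> $ 2 $ 2]]"

end

theory Submission
  imports Defs
begin

text \<open>Everything is computed in an eigenframe of a point \<open>P = U diag(l) U\<^sup>T\<close>. For a real function \<open>f\<close>, the
matrix \<open>f(P) = U diag(f(l)) U\<^sup>T\<close> depends only on \<open>P\<close>, and its derivative in direction \<open>v\<close> has, in the
frame \<open>U\<close>, the entries \<open>f[l\<^sub>i, l\<^sub>j] v\<^sub>i\<^sub>j\<close> with the divided differences \<open>f[x, y]\<close>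
(\<open>fun_calc_has_vector_derivative\<close>). Differentiability is only ever needed along a curve at one
time, which is the form in which it is proved. The exponential, the logarithm and the square root are
instances.

On the whole cone of positive definite matrices the function \<open>F(P) = d(I, P)\<^sup>2 / 2 = |log P|\<^sup>2 / 2\<close>
has the gradient \<open>P log P\<close>. Covariant differentiation of this field turns the divided difference of
\<open>x ln x\<close> into \<open>psi ((ln l\<^sub>i - ln l\<^sub>j) / 2)\<close>, because \<open>s coth s\<close> is what remains of
\<open>(x e\<^sup>x - y e\<^sup>y) / (e\<^sup>x - e\<^sup>y)\<close> after subtracting the mean of \<open>x\<close> and \<open>y\<close>. Hence

\<open>Hess F(v, v) = \<Sum>\<^sub>i\<^sub>j psi ((ln l\<^sub>i - ln l\<^sub>j) / 2) v\<^sub>i\<^sub>j\<^sup>2 / (l\<^sub>i l\<^sub>j)\<close>,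

while \<open>g(v, v)\<close> is the same sum without the factors \<open>psi\<close>. Since
\<open>|ln l\<^sub>i - ln l\<^sub>j| \<le> sqrt 2 |log P|\<close> and \<open>psi\<close> is even and increasing on the nonnegative half-line,
every factor is at most \<open>psi (D / sqrt 2)\<close> (\<open>ambient_hessian_bound\<close>).

An action fiber is totally geodesic, so its Hessian is the restriction of the ambient one
(\<open>fiber_has_hessian\<close>). Concretely, \<open>K = I - B (A\<^sup>T B)\<^sup>-\<^sup>1 A\<^sup>T\<close> does not depend on the point of the fiber,
\<open>Z \<mapsto> K Z K\<^sup>T\<close> is the orthogonal projection to the directions annihilating \<open>A\<close>, and the remaining
determinant condition costs a multiple of \<open>K P\<close>. The terms by which the projected gradient differs
from \<open>P log P\<close> cancel in the covariant derivative against every tangent vector.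

Sharpness needs two eigenvalues \<open>e\<^sup>x\<close>, \<open>e\<^sup>-\<^sup>x\<close> that use up the whole radius and a tangent vector that
mixes exactly these two eigendirections. The point \<open>diag(1, e\<^sup>x, e\<^sup>-\<^sup>x)\<close> with \<open>x = D / sqrt 2\<close> and the
off-diagonal direction do this (\<open>hessian_attains_psi\<close>). Since Hessians are unique on tangent vectors
(\<open>has_hessian_unique\<close>), no smaller majorant is possible.

For \<open>A = B\<close> the controller is the identity and the chart is \<open>\<Sigma> \<mapsto> Q diag(I, \<Sigma>) Q\<^sup>T\<close>, so the residual is
\<open>diag(0, - log \<Sigma>)\<close>. Its lower right block has trace \<open>- ln (det \<Sigma>) = 0\<close>; the correction in
\<open>fiber_W\<close> vanishes, and both posterior bounds become equalities at every point of the fiber, in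
particular along each radial geodesic (\<open>self_fiber_posterior_equalities\<close>).\<close>


section \<open>Matrix algebra and orthonormal frames\<close>

lemma bounded_bilinear_matrix_mult:
  "bounded_bilinear ((**) :: real^'n^'m \<Rightarrow> real^'p^'n \<Rightarrow> real^'p^'m)"
proof -
  have "bilinear ((**) :: real^'n^'m \<Rightarrow> real^'p^'n \<Rightarrow> real^'p^'m)"
    unfolding bilinear_def
    by (auto intro!: linearI simp: matrix_matrix_mult_def vec_eq_iff algebra_simps sum.distrib sum_distrib_left)
  then show ?thesis by (simp add: bilinear_conv_bounded_bilinear)
qed

interpretation matrix_mult: bounded_bilinear "(**) :: real^'n^'m \<Rightarrow> real^'p^'n \<Rightarrow> real^'p^'m"
  by (rule bounded_bilinear_matrix_mult)

lemma bounded_linear_transpose: "bounded_linear (transpose :: real^'n^'m \<Rightarrow> real^'m^'n)"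
  by (rule linear_conv_bounded_linear[THEN iffD1], rule linearI) (auto simp: transpose_def vec_eq_iff)

lemma transpose_diff: "transpose (X - Y) = transpose X - transpose (Y :: real^'n^'m)"
  by (simp add: transpose_def vec_eq_iff)

lemma transpose_zero [simp]: "transpose (0 :: real^'n^'m) = 0"
  by (simp add: transpose_def vec_eq_iff)

lemma bounded_linear_trace: "bounded_linear (trace :: real^'n^'n \<Rightarrow> real)"
  by (rule linear_conv_bounded_linear[THEN iffD1], rule linearI)
    (auto simp: trace_def sum.distrib sum_distrib_left)

lemma trace_scaleR: "trace (c *\<^sub>R (X :: real^'n^'n)) = c * trace X"
  by (simp add: trace_def sum_distrib_left)

lemma inner_matrix_eq_trace: "(X::real^'n^'m) \<bullet> Y = trace (transpose X ** Y)"
  by (simp add: inner_vec_def trace_def matrix_matrix_mult_def transpose_def) (rule sum.swap)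

lemma norm_matrix_sq: "(norm (X::real^'n^'m))\<^sup>2 = (\<Sum>i\<in>UNIV. \<Sum>j\<in>UNIV. (X$i$j)\<^sup>2)"
  unfolding power2_norm_eq_inner inner_vec_def by (simp add: power2_eq_square)

lemma matrix_inv_eqI:
  assumes "(X::real^'n^'n) ** Y = mat 1"
  shows "matrix_inv X = Y"
proof -
  have YX: "Y ** X = mat 1" using assms matrix_left_right_inverse by blast
  have "X ** matrix_inv X = mat 1 \<and> matrix_inv X ** X = mat 1"
    unfolding matrix_inv_def by (rule someI[of _ Y]) (use assms YX in auto)
  then show ?thesis by (metis YX matrix_mul_assoc matrix_mul_lid matrix_mul_rid)
qed

definition diag_mat :: "('n \<Rightarrow> real) \<Rightarrow> real^'n^'n" where
  "diag_mat l = (\<chi> i j. if i = j then l i else 0)"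

lemma diag_mat_mult_nth: "(diag_mat l ** X) $ i $ j = l i * X $ i $ j"
  by (simp add: diag_mat_def matrix_matrix_mult_def if_distrib[of "\<lambda>x. x * _"] cong: if_cong)

lemma mult_diag_mat_nth: "(X ** diag_mat l) $ i $ j = X $ i $ j * l j"
  by (simp add: diag_mat_def matrix_matrix_mult_def if_distrib cong: if_cong)

lemma diag_mat_mult: "diag_mat l ** diag_mat m = diag_mat (\<lambda>i. l i * m i)"
  by (simp add: vec_eq_iff diag_mat_mult_nth) (simp add: diag_mat_def)

lemma transpose_diag_mat [simp]: "transpose (diag_mat l) = diag_mat l"
  by (auto simp: diag_mat_def transpose_def vec_eq_iff)

lemma trace_diag_mat: "trace (diag_mat l) = sum l UNIV"
  by (simp add: diag_mat_def trace_def)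

lemma det_diag_mat: "det (diag_mat l) = prod l UNIV"
  by (subst det_diagonal) (auto simp: diag_mat_def)

lemma diag_mat_const: "diag_mat (\<lambda>_. c) = mat c"
  by (simp add: diag_mat_def mat_def)

lemma norm_diag_mat_sq: "(norm (diag_mat l))\<^sup>2 = (\<Sum>i\<in>UNIV. (l i)\<^sup>2)"
  by (simp add: norm_matrix_sq diag_mat_def if_distrib[of "\<lambda>x. x\<^sup>2"] cong: if_cong)

text \<open>Frames are allowed to be indexed by a type different from the one indexing the space. The
block coordinates of the reduced chart live on a sum type, and this generality transports
eigenvalues to them without choosing a bijection between index types.\<close>

definition orthonormal_frame :: "real^'n^'d \<Rightarrow> bool" where
  "orthonormal_frame U \<longleftrightarrow> transpose U ** U = mat 1 \<and> U ** transpose U = mat 1"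

lemma frame_transpose: "orthonormal_frame U \<Longrightarrow> orthonormal_frame (transpose U)"
  by (simp add: orthonormal_frame_def)

lemma frame_mult:
  assumes "orthonormal_frame U" "orthonormal_frame W"
  shows "orthonormal_frame (U ** W)"
proof -
  have "transpose (U ** W) ** (U ** W) = transpose W ** (transpose U ** U) ** W"
       "(U ** W) ** transpose (U ** W) = U ** (W ** transpose W) ** transpose U"
    by (simp_all add: matrix_transpose_mul matrix_mul_assoc)
  then show ?thesis using assms by (simp add: orthonormal_frame_def)
qed

text \<open>Rules for products bracketed to the left as well as to the right, so that simplification removes a
frame against its transpose inside a longer product.\<close>

lemma frame_cancel:
  assumes "orthonormal_frame U"
  shows "transpose U ** U = mat 1" "U ** transpose U = mat 1"
    "transpose U ** (U ** X) = X" "U ** (transpose U ** Y) = Y"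
    "Z ** transpose U ** U = Z" "V ** U ** transpose U = V"
  using assms by (simp_all add: orthonormal_frame_def matrix_mul_assoc)
    (metis matrix_mul_assoc matrix_mul_rid)+

lemma frame_norm:
  assumes "orthonormal_frame U" "orthonormal_frame W"
  shows "norm (U ** X ** W) = norm X"
proof -
  have "(norm (U ** X ** W))\<^sup>2 = trace (transpose (U ** X ** W) ** (U ** X ** W))"
    by (simp add: power2_norm_eq_inner inner_matrix_eq_trace)
  also have "transpose (U ** X ** W) ** (U ** X ** W)
      = transpose W ** (transpose X ** (transpose U ** U) ** X ** W)"
    by (simp add: matrix_transpose_mul matrix_mul_assoc)
  also have "trace \<dots> = trace (transpose X ** X ** (W ** transpose W))"
    using assms by (subst trace_mul_sym) (simp add: frame_cancel matrix_mul_assoc)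
  also have "\<dots> = (norm X)\<^sup>2"
    using assms by (simp add: frame_cancel power2_norm_eq_inner inner_matrix_eq_trace)
  finally show ?thesis by simp
qed

lemma frame_trace:
  assumes "orthonormal_frame U"
  shows "trace (U ** X ** transpose U) = trace X"
  using assms by (subst trace_mul_sym) (simp add: frame_cancel)

lemma frame_column_sum:
  assumes "orthonormal_frame U"
  shows "(\<Sum>i\<in>UNIV. (U$i$j)\<^sup>2) = 1"
proof -
  have "(\<Sum>i\<in>UNIV. (U$i$j)\<^sup>2) = (transpose U ** U)$j$j"
    by (simp add: matrix_matrix_mult_def transpose_def power2_eq_square)
  then show ?thesis using assms by (simp add: frame_cancel mat_def)
qed

section \<open>The spectral theorem\<close>

lemma inner_symmetric_matrix:
  fixes P :: "real^'d^'d"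
  assumes "transpose P = P"
  shows "x \<bullet> (P *v y) = (P *v x) \<bullet> y"
  using assms by (metis dot_lmul_matrix transpose_matrix_vector)

text \<open>Rayleigh's principle: a maximiser of the quadratic form on the unit sphere of an invariant subspace is an
eigenvector.\<close>

lemma symmetric_invariant_eigenvector:
  fixes P :: "real^'d^'d"
  assumes sym: "transpose P = P" and S: "subspace S" and a: "a \<in> S" "a \<noteq> 0"
    and inv: "\<And>x. x \<in> S \<Longrightarrow> P *v x \<in> S"
  obtains x m where "x \<in> S" "norm x = 1" "P *v x = m *\<^sub>R x"
proof -
  let ?C = "S \<inter> sphere 0 1"
  have "compact ?C"
    by (simp add: closed_Int_compact S closed_subspace)
  moreover have "(1 / norm a) *\<^sub>R a \<in> ?C"
    using a S by (auto simp: subspace_scale)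
  then have "?C \<noteq> {}" by blast
  moreover have "continuous_on ?C (\<lambda>x. x \<bullet> (P *v x))"
    by (intro continuous_intros linear_continuous_on matrix_vector_mul_bounded_linear)
  ultimately obtain x where x: "x \<in> ?C" and max: "\<And>y. y \<in> ?C \<Longrightarrow> y \<bullet> (P *v y) \<le> x \<bullet> (P *v x)"
    using continuous_attains_sup by meson
  define m where "m = x \<bullet> (P *v x)"
  have xS: "x \<in> S" and nx: "norm x = 1" using x by auto
  have le: "y \<bullet> (P *v y) \<le> m * (y \<bullet> y)" if "y \<in> S" for y
  proof (cases "y = 0")
    case False
    let ?u = "(1 / norm y) *\<^sub>R y"
    have "?u \<in> ?C" using False that S by (auto simp: subspace_scale)
    from max[OF this] have "(y \<bullet> (P *v y)) / (norm y)\<^sup>2 \<le> m"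
      by (simp add: m_def matrix_vector_mult_scaleR power2_eq_square)
    then show ?thesis using False
      by (simp add: divide_le_eq power2_norm_eq_inner)
  qed simp
  \<comment> \<open>First-order condition: the defect \<open>m |y|\<^sup>2 - y \<bullet> P y\<close> is nonnegative on \<open>S\<close> and vanishes at \<open>x\<close>.\<close>
  have orth: "z \<bullet> (m *\<^sub>R x - P *v x) = 0" if z: "z \<in> S" for z
  proof -
    define b where "b = z \<bullet> (m *\<^sub>R x - P *v x)"
    define q where "q = m * (z \<bullet> z) - z \<bullet> (P *v z)"
    have nn: "0 \<le> 2 * t * b + t\<^sup>2 * q" for t
    proof -
      have "x + t *\<^sub>R z \<in> S" using S xS z by (simp add: subspace_add subspace_scale)
      from le[OF this] have "0 \<le> m * ((x + t *\<^sub>R z) \<bullet> (x + t *\<^sub>R z)) - (x + t *\<^sub>R z) \<bullet> (P *v (x + t *\<^sub>R z))"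
        by simp
      also have "\<dots> = m * (x \<bullet> x) - x \<bullet> (P *v x) + 2 * t * b + t\<^sup>2 * q"
        using inner_symmetric_matrix[OF sym, of x z]
        by (simp add: b_def q_def algebra_simps inner_add_left inner_add_right inner_diff_right
            inner_commute power2_eq_square matrix_vector_mult_scaleR)
      also have "m * (x \<bullet> x) - x \<bullet> (P *v x) = 0"
        using nx by (simp add: m_def dot_square_norm)
      finally show ?thesis by simp
    qed
    show "b = 0"
    proof (rule ccontr)
      assume b: "b \<noteq> 0"
      define d where "d = \<bar>q\<bar> + 1"
      have d: "d > 0" by (simp add: d_def add_nonneg_pos)
      \<comment> \<open>A step against the sign of \<open>b\<close>, short enough for the linear term to dominate.\<close>
      define s where "s = - b / d"
      have "2 * s * b + s\<^sup>2 * q \<le> 2 * s * b + s\<^sup>2 * d"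
        unfolding d_def by (intro add_left_mono mult_left_mono) auto
      also have "s\<^sup>2 * d = - (s * b)"
        using d unfolding s_def by (simp add: power2_eq_square field_simps)
      also have "2 * s * b + - (s * b) = - (b\<^sup>2 / d)"
        unfolding s_def by (simp add: power2_eq_square)
      also have "\<dots> < 0" using b d by simp
      finally show False using nn[of s] by simp
    qed
  qed
  have "m *\<^sub>R x - P *v x \<in> S" using S xS inv by (simp add: subspace_diff subspace_scale)
  from orth[OF this] have "m *\<^sub>R x - P *v x = 0" by simp
  then show ?thesis using that[OF xS nx, of m] by simp
qed

definition eigenframe :: "real^'n^'d \<Rightarrow> ('n \<Rightarrow> real) \<Rightarrow> real^'d^'d \<Rightarrow> bool" where
  "eigenframe U l P \<longleftrightarrow> orthonormal_frame U \<and> P = U ** diag_mat l ** transpose U"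

lemma eigenframe_frame: "eigenframe U l P \<Longrightarrow> orthonormal_frame U"
  by (simp add: eigenframe_def)

lemma eigenframe_symmetric: "eigenframe U l P \<Longrightarrow> transpose P = P"
  by (auto simp: eigenframe_def matrix_transpose_mul matrix_mul_assoc)

text \<open>Orthonormal sets of eigenvectors are enlarged one vector at a time: the orthogonal complement of such a
set is invariant under a symmetric matrix, so it contains another eigenvector.\<close>

theorem spectral_theorem:
  fixes P :: "real^'d^'d"
  assumes sym: "transpose P = P"
  obtains U :: "real^'d^'d" and l where "eigenframe U l P"
proof -
  define ok where "ok E \<longleftrightarrow> finite E \<and> pairwise orthogonal E \<and> (\<forall>x\<in>E. norm x = 1 \<and> (\<exists>m. P *v x = m *\<^sub>R x))"
    for E
  have ind: "independent E" if "ok E" for E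
    using that unfolding ok_def by (metis norm_zero pairwise_orthogonal_independent zero_neq_one)
  have "\<exists>E. ok E \<and> card E = k" if "k \<le> CARD('d)" for k
    using that
  proof (induction k)
    case 0
    show ?case by (rule exI[of _ "{}"]) (simp add: ok_def)
  next
    case (Suc k)
    then obtain E where E: "ok E" "card E = k" by auto
    define S where "S = {y. \<forall>x\<in>E. orthogonal x y}"
    have "dim (span E) < DIM(real^'d)"
      using Suc.prems E ind[OF E(1)] by (simp add: dim_eq_card_independent)
    then have "span E \<noteq> UNIV" by (metis dim_UNIV less_irrefl)
    then obtain a where a: "a \<noteq> 0" "\<forall>x\<in>span E. a \<bullet> x = 0"
      using span_not_UNIV_orthogonal by blast
    have aS: "a \<in> S" using a by (auto simp: S_def orthogonal_def inner_commute span_base)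
    have inv: "P *v y \<in> S" if y: "y \<in> S" for y
      unfolding S_def orthogonal_def
    proof (intro CollectI ballI)
      fix x assume x: "x \<in> E"
      then obtain m where "P *v x = m *\<^sub>R x" using E by (auto simp: ok_def)
      then show "x \<bullet> (P *v y) = 0"
        using x y by (simp add: inner_symmetric_matrix[OF sym] S_def orthogonal_def)
    qed
    obtain x m where x: "x \<in> S" "norm x = 1" "P *v x = m *\<^sub>R x"
      using symmetric_invariant_eigenvector[OF sym subspace_orthogonal_to_vectors[of E, folded S_def] aS a(1) inv]
      by blast
    have "x \<notin> E" using x by (auto simp: S_def orthogonal_self)
    then have "ok (insert x E) \<and> card (insert x E) = Suc k"
      using E x by (auto simp: ok_def pairwise_insert S_def orthogonal_commute)
    then show ?case by blast
  qed
  then obtain E where E: "ok E" "card E = CARD('d)" by blast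
  have fE: "finite E" using E(1) by (simp add: ok_def)
  obtain f where f: "bij_betw f (UNIV :: 'd set) E"
    using finite_same_card_bij[of "UNIV :: 'd set" E] E fE by auto
  have fin: "f j \<in> E" for j using f by (auto simp: bij_betw_def)
  define l where "l j = (SOME m. P *v f j = m *\<^sub>R f j)" for j
  have l: "P *v f j = l j *\<^sub>R f j" for j
  proof -
    have "\<exists>m. P *v f j = m *\<^sub>R f j" using E fin by (auto simp: ok_def)
    from someI_ex[OF this] show ?thesis by (simp add: l_def)
  qed
  define U :: "real^'d^'d" where "U = (\<chi> i j. f j $ i)"
  have ip: "f i \<bullet> f j = (if i = j then 1 else 0)" for i j
  proof (cases "i = j")
    case True
    then show ?thesis using E fin[of j] by (auto simp: ok_def dot_square_norm)
  next
    case False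
    then have "f i \<noteq> f j" using f by (auto simp: bij_betw_def inj_on_def)
    then show ?thesis using False E(1) fin by (auto simp: ok_def pairwise_def orthogonal_def)
  qed
  have UU: "transpose U ** U = mat 1"
    using ip by (simp add: U_def transpose_def matrix_matrix_mult_def mat_def vec_eq_iff inner_vec_def)
  then have fr: "orthonormal_frame U"
    using matrix_left_right_inverse by (auto simp: orthonormal_frame_def)
  have "(P ** U) $ i $ j = (U ** diag_mat l) $ i $ j" for i j
  proof -
    have "(P ** U) $ i $ j = (P *v f j) $ i"
      by (simp add: U_def matrix_matrix_mult_def matrix_vector_mult_def)
    then show ?thesis by (simp add: l mult_diag_mat_nth) (simp add: U_def)
  qed
  then have "P ** U = U ** diag_mat l" by (simp add: vec_eq_iff)
  then have "P ** U ** transpose U = U ** diag_mat l ** transpose U" by simp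
  then show ?thesis using fr that by (simp add: eigenframe_def frame_cancel)
qed

section \<open>Functional calculus of symmetric matrices\<close>

text \<open>The key to all estimates. Between the eigenbasis of \<open>P\<close> and that of \<open>R\<close>, the difference
\<open>f(P) - g(R)\<close> has entries that are scalar differences times a fixed orthogonal matrix, although the two
matrices need not commute.\<close>

lemma mixed_frame_entry:
  assumes U: "eigenframe U l P" and W: "eigenframe W m R"
  shows "(transpose U ** (U ** diag_mat (\<lambda>i. f (l i)) ** transpose U - W ** diag_mat (\<lambda>i. g (m i)) ** transpose W) ** W) $ i $ j
    = (f (l i) - g (m j)) * (transpose U ** W) $ i $ j"
proof -
  have fU: "orthonormal_frame U" and fW: "orthonormal_frame W" using U W by (auto simp: eigenframe_def)
  have "transpose U ** (U ** diag_mat (\<lambda>i. f (l i)) ** transpose U - W ** diag_mat (\<lambda>i. g (m i)) ** transpose W) ** W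
     = diag_mat (\<lambda>i. f (l i)) ** (transpose U ** W) - (transpose U ** W) ** diag_mat (\<lambda>i. g (m i))"
    using frame_cancel[OF fU] frame_cancel[OF fW]
    by (simp add: matrix_mult.diff_left matrix_mult.diff_right matrix_mul_assoc)
  then show ?thesis by (simp add: diag_mat_mult_nth mult_diag_mat_nth left_diff_distrib mult.commute)
qed

lemma mixed_frame_norm:
  assumes U: "eigenframe U l P" and W: "eigenframe W m R"
  shows "(norm (U ** diag_mat (\<lambda>i. f (l i)) ** transpose U - W ** diag_mat (\<lambda>i. g (m i)) ** transpose W))\<^sup>2
    = (\<Sum>i\<in>UNIV. \<Sum>j\<in>UNIV. (f (l i) - g (m j))\<^sup>2 * ((transpose U ** W) $ i $ j)\<^sup>2)" (is "(norm ?X)\<^sup>2 = _")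
proof -
  have fU: "orthonormal_frame U" and fW: "orthonormal_frame W" using U W by (auto simp: eigenframe_def)
  have "norm ?X = norm (transpose U ** ?X ** W)"
    using frame_norm[OF frame_transpose[OF fU] fW] by simp
  then show ?thesis
    by (simp add: norm_matrix_sq mixed_frame_entry[OF U W] power_mult_distrib)
qed

text \<open>If the spectra are compared through two frames of the same matrix, an overlap between columns of
different eigenvalues is zero, so \<open>f\<close> only sees equal eigenvalues.\<close>

lemma frame_functional_unique:
  assumes U: "eigenframe U l P" and W: "eigenframe W m P"
  shows "U ** diag_mat (\<lambda>i. f (l i)) ** transpose U = W ** diag_mat (\<lambda>i. f (m i)) ** transpose W" (is "?X = ?Y")
proof -
  have "(l i - m j) * (transpose U ** W) $ i $ j = 0" for i j
    using mixed_frame_entry[OF U W, of "\<lambda>x. x" "\<lambda>x. x" i j] U W by (simp add: eigenframe_def)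
  then have "(f (l i) - f (m j))\<^sup>2 * ((transpose U ** W) $ i $ j)\<^sup>2 = 0" for i j
    by (metis mult_eq_0_iff right_minus_eq zero_power2)
  then have "(norm (?X - ?Y))\<^sup>2 = 0"
    unfolding mixed_frame_norm[OF U W] by (intro sum.neutral ballI)
  then show ?thesis by simp
qed

text \<open>For symmetric \<open>P\<close> every choice gives the same value; other matrices have no eigenframe.\<close>

definition fun_calc :: "(real \<Rightarrow> real) \<Rightarrow> real^'d^'d \<Rightarrow> real^'d^'d" where
  "fun_calc f P = (SOME M. \<exists>(U::real^'d^'d) l. eigenframe U l P \<and> M = U ** diag_mat (\<lambda>i. f (l i)) ** transpose U)"

lemma fun_calc_eigenframe:
  fixes P :: "real^'d^'d"
  assumes U: "eigenframe U l P"
  shows "fun_calc f P = U ** diag_mat (\<lambda>i. f (l i)) ** transpose U"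
proof -
  obtain V :: "real^'d^'d" and m where V: "eigenframe V m P"
    using spectral_theorem eigenframe_symmetric[OF U] by blast
  show ?thesis unfolding fun_calc_def
  proof (rule someI2_ex)
    show "\<exists>M. \<exists>(U::real^'d^'d) l. eigenframe U l P \<and> M = U ** diag_mat (\<lambda>i. f (l i)) ** transpose U" using V by blast
  next
    fix M assume "\<exists>(V::real^'d^'d) m. eigenframe V m P \<and> M = V ** diag_mat (\<lambda>i. f (m i)) ** transpose V"
    then show "M = U ** diag_mat (\<lambda>i. f (l i)) ** transpose U"
      using frame_functional_unique[OF U] by metis
  qed
qed

lemma eigenframe_fun_calc: "eigenframe U l P \<Longrightarrow> eigenframe U (\<lambda>i. f (l i)) (fun_calc f P)"
  by (simp add: fun_calc_eigenframe eigenframe_def)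

section \<open>Exponential, logarithm and affine-invariant distance\<close>

lemma power_conj_diag_mat:
  assumes "orthonormal_frame U"
  shows "((**) (U ** diag_mat l ** transpose U) ^^ k) (mat 1) = U ** diag_mat (\<lambda>i. l i ^ k) ** transpose U"
proof (induction k)
  case 0
  then show ?case using assms by (simp add: diag_mat_const frame_cancel)
next
  case (Suc k)
  have "((**) (U ** diag_mat l ** transpose U) ^^ Suc k) (mat 1)
      = U ** diag_mat l ** (transpose U ** (U ** (diag_mat (\<lambda>i. l i ^ k) ** transpose U)))"
    using Suc by (simp add: matrix_mul_assoc)
  also have "\<dots> = U ** (diag_mat l ** diag_mat (\<lambda>i. l i ^ k)) ** transpose U"
    by (simp add: matrix_mul_assoc frame_cancel[OF assms])
  finally show ?case by (simp add: diag_mat_mult)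
qed

lemma mat_exp_eigenframe:
  assumes U: "eigenframe U l X"
  shows "mat_exp X = U ** diag_mat (\<lambda>i. exp (l i)) ** transpose U"
proof -
  have fU: "orthonormal_frame U" and X: "X = U ** diag_mat l ** transpose U"
    using U by (auto simp: eigenframe_def)
  have lim: "(\<lambda>n. diag_mat (\<lambda>i. \<Sum>k<n. l i ^ k /\<^sub>R fact k)) \<longlonglongrightarrow> diag_mat (\<lambda>i. exp (l i))"
    unfolding diag_mat_def
  proof (intro tendsto_vec_lambda)
    fix i j
    have "(\<lambda>n. \<Sum>k<n. l i ^ k /\<^sub>R fact k) \<longlonglongrightarrow> exp (l i)"
      using exp_converges[of "l i"] by (simp add: sums_def)
    then show "(\<lambda>n. if i = j then \<Sum>k<n. l i ^ k /\<^sub>R fact k else 0) \<longlonglongrightarrow> (if i = j then exp (l i) else 0)"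
      by (cases "i = j") simp_all
  qed
  have "(\<Sum>k<n. (1 / fact k) *\<^sub>R (((**) X ^^ k) (mat 1)))
      = U ** diag_mat (\<lambda>i. \<Sum>k<n. l i ^ k /\<^sub>R fact k) ** transpose U" for n
  proof -
    have "diag_mat (\<lambda>i. \<Sum>k<n. l i ^ k /\<^sub>R fact k) = (\<Sum>k<n. (1 / fact k) *\<^sub>R diag_mat (\<lambda>i. l i ^ k))"
      by (auto simp: diag_mat_def vec_eq_iff divide_inverse)
    then show ?thesis
      by (simp add: X power_conj_diag_mat[OF fU] matrix_mult.sum_left matrix_mult.sum_right
          matrix_mult.scaleR_left matrix_mult.scaleR_right)
  qed
  then have "(\<lambda>k. (1 / fact k) *\<^sub>R (((**) X ^^ k) (mat 1))) sums (U ** diag_mat (\<lambda>i. exp (l i)) ** transpose U)"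
    unfolding sums_def by (simp only:) (intro matrix_mult.tendsto tendsto_const lim)
  then show ?thesis unfolding mat_exp_def by (rule sums_unique[symmetric])
qed

lemma spd_symmetric: "P \<in> spd \<Longrightarrow> transpose P = P"
  by (simp add: spd_def)

lemma quadratic_form_eigenframe:
  assumes "eigenframe U l P"
  shows "x \<bullet> (P *v x) = (\<Sum>i\<in>UNIV. l i * ((transpose U *v x) $ i)\<^sup>2)"
proof -
  have P: "P = U ** diag_mat l ** transpose U" using assms by (simp add: eigenframe_def)
  define y where "y = transpose U *v x"
  have "x \<bullet> (P *v x) = x \<bullet> (U *v (diag_mat l *v y))"
    by (simp add: P y_def matrix_vector_mul_assoc matrix_mul_assoc del: transpose_matrix_vector)
  also have "\<dots> = y \<bullet> (diag_mat l *v y)"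
    by (simp add: y_def dot_lmul_matrix)
  also have "\<dots> = (\<Sum>i\<in>UNIV. l i * (y $ i)\<^sup>2)"
    by (simp add: inner_vec_def diag_mat_def matrix_vector_mult_def power2_eq_square
        if_distrib[of "\<lambda>x. x * _"] mult.left_commute cong: if_cong)
  finally show ?thesis by (simp add: y_def)
qed

lemma eigenframe_spd_iff:
  fixes P :: "real^'d^'d"
  assumes U: "eigenframe U l P"
  shows "P \<in> spd \<longleftrightarrow> (\<forall>i. l i > 0)"
proof -
  have fU: "orthonormal_frame U" using U by (simp add: eigenframe_def)
  have "\<forall>i. l i > 0" if "P \<in> spd"
  proof
    fix i
    define x where "x = U *v axis i 1"
    have Ux: "transpose U *v x = axis i 1"
      by (simp add: x_def matrix_vector_mul_assoc frame_cancel[OF fU] del: transpose_matrix_vector)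
    then have "x \<noteq> 0" by (metis axis_eq_0_iff matrix_vector_mult_0_right zero_neq_one)
    then have "0 < x \<bullet> (P *v x)" using that by (simp add: spd_def)
    also have "\<dots> = (\<Sum>j\<in>UNIV. if j = i then l i else 0)"
      unfolding quadratic_form_eigenframe[OF U] Ux by (intro sum.cong) (auto simp: axis_def)
    finally show "l i > 0" by simp
  qed
  moreover have "P \<in> spd" if l: "\<forall>i. l i > 0"
    unfolding spd_def
  proof (intro CollectI conjI allI impI)
    show "transpose P = P" by (rule eigenframe_symmetric[OF U])
    fix x :: "real^'d" assume x: "x \<noteq> 0"
    define y where "y = transpose U *v x"
    have "U *v y = x"
      by (simp add: y_def matrix_vector_mul_assoc frame_cancel[OF fU] del: transpose_matrix_vector)
    then have "y \<noteq> 0" using x by auto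
    then obtain i where "y $ i \<noteq> 0" by (auto simp: vec_eq_iff)
    then have "0 < (\<Sum>i\<in>UNIV. l i * (y $ i)\<^sup>2)"
      using l by (intro sum_pos2[of UNIV i]) (auto simp: less_imp_le)
    then show "0 < x \<bullet> (P *v x)" by (simp add: quadratic_form_eigenframe[OF U] y_def)
  qed
  ultimately show ?thesis by blast
qed

lemma spd_eigenframe:
  fixes P :: "real^'d^'d"
  assumes "P \<in> spd"
  obtains U :: "real^'d^'d" and l where "eigenframe U l P" "\<And>i. l i > 0"
proof -
  obtain U :: "real^'d^'d" and l where U: "eigenframe U l P"
    using spectral_theorem[OF spd_symmetric[OF assms]] .
  then show ?thesis using that eigenframe_spd_iff[OF U] assms by blast
qed

text \<open>Two symmetric logarithms of the same matrix agree, as each is recovered by applying \<open>ln\<close> to its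
exponential; hence the description by \<open>THE\<close> denotes.\<close>

lemma mat_log_exp:
  fixes X :: "real^'d^'d"
  assumes "transpose X = X"
  shows "mat_log (mat_exp X) = X"
  unfolding mat_log_def
proof (rule the_equality)
  show "transpose X = X \<and> mat_exp X = mat_exp X" using assms by simp
next
  have log: "Y = fun_calc ln (mat_exp Y)" if Y: "transpose Y = Y" for Y :: "real^'d^'d"
  proof -
    obtain U :: "real^'d^'d" and l where U: "eigenframe U l Y" using spectral_theorem[OF Y] .
    then have "eigenframe U (\<lambda>i. exp (l i)) (mat_exp Y)"
      by (simp add: eigenframe_def mat_exp_eigenframe)
    from fun_calc_eigenframe[OF this, of ln] show ?thesis using U by (simp add: eigenframe_def)
  qed
  fix Y assume "transpose Y = Y \<and> mat_exp Y = mat_exp X"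
  then show "Y = X" using log[of X] log[of Y] assms by simp
qed

lemma mat_log_eigenframe:
  assumes U: "eigenframe U l P" and l: "\<And>i. l i > 0"
  shows "mat_log P = U ** diag_mat (\<lambda>i. ln (l i)) ** transpose U"
proof -
  define X where "X = U ** diag_mat (\<lambda>i. ln (l i)) ** transpose U"
  have "eigenframe U (\<lambda>i. ln (l i)) X" using U by (simp add: eigenframe_def X_def)
  moreover from mat_exp_eigenframe[OF this] have "mat_exp X = P"
    using U l by (simp add: eigenframe_def)
  ultimately show ?thesis using mat_log_exp[of X] eigenframe_symmetric by (auto simp: X_def)
qed

lemma mat_log_eq_fun_calc:
  fixes P :: "real^'d^'d"
  assumes "P \<in> spd"
  shows "mat_log P = fun_calc ln P"
proof -
  obtain U :: "real^'d^'d" and l where U: "eigenframe U l P" "\<And>i. l i > 0"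
    using spd_eigenframe[OF assms] by blast
  show ?thesis unfolding mat_log_eigenframe[OF U] fun_calc_eigenframe[OF U(1)] ..
qed

lemma eigenframe_mult:
  assumes "eigenframe U l P" "eigenframe U m R"
  shows "P ** R = U ** diag_mat (\<lambda>i. l i * m i) ** transpose U"
proof -
  have "P ** R = U ** diag_mat l ** (transpose U ** U) ** diag_mat m ** transpose U"
    using assms by (simp add: eigenframe_def matrix_mul_assoc)
  also have "\<dots> = U ** (diag_mat l ** diag_mat m) ** transpose U"
    using assms by (simp add: eigenframe_def frame_cancel matrix_mul_assoc)
  finally show ?thesis by (simp add: diag_mat_mult)
qed

lemma eigenframe_one: "orthonormal_frame U \<Longrightarrow> eigenframe U (\<lambda>_. 1) (mat 1)"
  by (simp add: eigenframe_def diag_mat_const frame_cancel)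

lemma matrix_inv_eigenframe:
  assumes U: "eigenframe U l P" and l: "\<And>i. l i \<noteq> 0"
  shows "eigenframe U (\<lambda>i. inverse (l i)) (matrix_inv P)"
proof -
  define R where "R = U ** diag_mat (\<lambda>i. inverse (l i)) ** transpose U"
  have R: "eigenframe U (\<lambda>i. inverse (l i)) R" using U by (simp add: eigenframe_def R_def)
  have "P ** R = mat 1"
    using eigenframe_mult[OF U R] l U by (simp add: eigenframe_def diag_mat_const frame_cancel)
  then show ?thesis using R by (simp add: matrix_inv_eqI)
qed

lemma mat_sqrt_eigenframe:
  fixes P :: "real^'d^'d"
  assumes U: "eigenframe U l P" and l: "\<And>i. l i > 0"
  shows "eigenframe U (\<lambda>i. sqrt (l i)) (mat_sqrt P)"
proof -
  define S where "S = U ** diag_mat (\<lambda>i. sqrt (l i)) ** transpose U"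
  have S: "eigenframe U (\<lambda>i. sqrt (l i)) S" using U by (simp add: eigenframe_def S_def)
  have "mat_sqrt P = S" unfolding mat_sqrt_def
  proof (rule the_equality)
    show "S \<in> spd \<and> S ** S = P"
      using eigenframe_mult[OF S S] l U eigenframe_spd_iff[OF S] by (simp add: eigenframe_def less_imp_le)
  next
    fix R assume R: "R \<in> spd \<and> R ** R = P"
    then obtain V :: "real^'d^'d" and m where V: "eigenframe V m R" "\<And>i. m i > 0"
      using spd_eigenframe by blast
    then have "eigenframe V (\<lambda>i. m i * m i) P" using R eigenframe_mult[OF V(1) V(1)] by (simp add: eigenframe_def)
    from fun_calc_eigenframe[OF this, of sqrt] fun_calc_eigenframe[OF U, of sqrt]
    show "R = S" using V by (simp add: S_def eigenframe_def less_imp_le)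
  qed
  then show ?thesis using S by simp
qed

lemma ai_whiten_one [simp]: "ai_whiten (mat 1) (P :: real^'d^'d) = P"
proof -
  have e: "eigenframe (mat 1) (\<lambda>_. 1) (mat 1 :: real^'d^'d)"
    by (simp add: eigenframe_def orthonormal_frame_def diag_mat_const)
  then have "mat_sqrt (mat 1 :: real^'d^'d) = mat 1"
    using mat_sqrt_eigenframe[OF e] by (simp add: eigenframe_def diag_mat_const)
  then show ?thesis by (simp add: ai_whiten_def matrix_inv_eqI)
qed

lemma ai_dist_one: "ai_dist (mat 1) P = norm (mat_log P)"
  by (simp add: ai_dist_def)

lemma log_whitened_one_eigenframe:
  assumes U: "eigenframe U l P" and l: "\<And>i. l i > 0"
  shows "mat_log (ai_whiten P (mat 1)) = U ** diag_mat (\<lambda>i. - ln (l i)) ** transpose U"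
proof -
  have S: "eigenframe U (\<lambda>i. inverse (sqrt (l i))) (matrix_inv (mat_sqrt P))"
    by (rule matrix_inv_eigenframe[OF mat_sqrt_eigenframe[OF U l]]) (use l in \<open>auto simp: less_imp_neq[THEN not_sym]\<close>)
  have "inverse (sqrt (l i)) * inverse (sqrt (l i)) = inverse (l i)" for i
    using l[of i] by (metis abs_of_pos inverse_mult_distrib real_sqrt_mult_self)
  then have "ai_whiten P (mat 1) = U ** diag_mat (\<lambda>i. inverse (l i)) ** transpose U"
    unfolding ai_whiten_def using eigenframe_mult[OF S S] by simp
  then have "eigenframe U (\<lambda>i. inverse (l i)) (ai_whiten P (mat 1))"
    using U by (simp add: eigenframe_def)
  from mat_log_eigenframe[OF this] show ?thesis using l by (simp add: ln_inverse)
qed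

lemma norm_conj_diag:
  assumes "orthonormal_frame U"
  shows "norm (U ** diag_mat l ** transpose U) = sqrt (\<Sum>i\<in>UNIV. (l i)\<^sup>2)"
  using frame_norm[OF assms frame_transpose[OF assms], of "diag_mat l"] norm_diag_mat_sq[of l]
  by (metis norm_ge_zero real_sqrt_pow2_iff real_sqrt_unique)

lemma det_square_eigenframe:
  fixes U :: "real^'d^'d"
  assumes U: "eigenframe U l P"
  shows "det P = prod l UNIV"
proof -
  have fU: "orthonormal_frame U" using U by (simp add: eigenframe_def)
  have "det P = det (diag_mat l) * (det (U ** transpose U))"
    using U by (simp add: eigenframe_def det_mul)
  then show ?thesis by (simp add: frame_cancel[OF fU] det_diag_mat)
qed

text \<open>The trace of the logarithm does not depend on the frame, and for a square frame it is the logarithm of the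
determinant. This gives determinants also from frames with a different index type, where the
multiplicativity of \<open>det\<close> cannot be applied.\<close>

lemma det_eigenframe:
  fixes P :: "real^'d^'d"
  assumes U: "eigenframe U l P" and l: "\<And>i. l i > 0"
  shows "det P = exp (\<Sum>i\<in>UNIV. ln (l i))"
proof -
  have "P \<in> spd" using eigenframe_spd_iff[OF U] l by blast
  then obtain V :: "real^'d^'d" and m where V: "eigenframe V m P" "\<And>i. m i > 0"
    using spd_eigenframe by blast
  have "(\<Sum>i\<in>UNIV. ln (l i)) = trace (fun_calc ln P)"
    by (simp add: fun_calc_eigenframe[OF U] trace_diag_mat frame_trace[OF eigenframe_frame[OF U]])
  also have "\<dots> = (\<Sum>i\<in>UNIV. ln (m i))"
    by (simp add: fun_calc_eigenframe[OF V(1)] trace_diag_mat frame_trace[OF eigenframe_frame[OF V(1)]])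
  finally show ?thesis using V by (simp add: det_square_eigenframe[OF V(1)] exp_sum)
qed

section \<open>Continuity and derivative of the functional calculus\<close>

text \<open>Continuity of the calculus at \<open>P\<close> from continuity of \<open>g\<close> at the finitely many eigenvalues of \<open>P\<close>. In a
mixed frame it suffices to bound \<open>(g(l i) - g(m j))\<^sup>2\<close> by a small constant plus a multiple of
\<open>(l i - m j)\<^sup>2\<close>: the first contributes little because the squared overlaps sum to the dimension, the second
because it adds up to \<open>|P - R|\<^sup>2\<close>.\<close>

lemma fun_calc_tendsto:
  fixes P :: "real^'d^'d"
  assumes U: "eigenframe (U :: real^'d^'d) l P" and g: "\<And>i. isCont g (l i)"
    and R: "(R \<longlongrightarrow> P) F" and sym: "\<forall>\<^sub>F t in F. transpose (R t) = R t"
  shows "((\<lambda>t. fun_calc g (R t)) \<longlongrightarrow> fun_calc g P) F"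
proof (rule tendstoI)
  fix e0 :: real assume e0: "e0 > 0"
  define e where "e = e0 / (2 * sqrt (real CARD('d)))"
  have e: "e > 0" using e0 by (simp add: e_def)
  have e_card: "real CARD('d) * e\<^sup>2 = e0\<^sup>2 / 4"
    by (simp add: e_def power_divide power_mult_distrib)
  have "\<exists>d>0. \<forall>x. \<bar>x - l i\<bar> < d \<longrightarrow> \<bar>g x - g (l i)\<bar> < e" for i
    using g[of i] e by (auto simp: continuous_at_eps_delta dist_real_def)
  then obtain d where d: "\<And>i. d i > 0" "\<And>i x. \<bar>x - l i\<bar> < d i \<Longrightarrow> \<bar>g x - g (l i)\<bar> < e"
    by metis
  define r where "r = Min (range d)"
  have r: "r > 0" "\<And>i. r \<le> d i" using d by (auto simp: r_def)
  \<comment> \<open>\<open>M\<close> bounds \<open>|g(l i) - g y|\<close> for every \<open>y\<close> within \<open>r\<close> of some, possibly different, eigenvalue of \<open>P\<close>.\<close>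
  define M where "M = e + (\<Sum>i\<in>UNIV. \<Sum>k\<in>UNIV. \<bar>g (l i) - g (l k)\<bar>)"
  have M: "\<bar>g (l i) - g (l k)\<bar> \<le> M - e" for i k
  proof -
    have "\<bar>g (l i) - g (l k)\<bar> \<le> (\<Sum>k\<in>UNIV. \<bar>g (l i) - g (l k)\<bar>)"
      by (rule member_le_sum) auto
    also have "\<dots> \<le> (\<Sum>i\<in>UNIV. \<Sum>k\<in>UNIV. \<bar>g (l i) - g (l k)\<bar>)"
      by (rule member_le_sum[of _ _ "\<lambda>i. \<Sum>k\<in>UNIV. \<bar>g (l i) - g (l k)\<bar>"]) (auto intro: sum_nonneg)
    finally show ?thesis by (simp add: M_def)
  qed
  define c where "c = (M / r)\<^sup>2"
  have c: "c \<ge> 0" by (simp add: c_def)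
  define s where "s = min r (e0 / (2 * (sqrt c + 1)))"
  have s: "s > 0" using r e0 c by (simp add: s_def add_nonneg_pos)
  have cs: "c * s\<^sup>2 \<le> e0\<^sup>2 / 4"
  proof -
    have "sqrt c + 1 > 0" using c by (simp add: add_nonneg_pos)
    then have q: "(sqrt c + 1) * (e0 / (2 * (sqrt c + 1))) = e0 / 2"
      by (metis less_irrefl mult.commute nonzero_mult_divide_mult_cancel_left times_divide_eq_right)
    have "sqrt c * s \<le> (sqrt c + 1) * (e0 / (2 * (sqrt c + 1)))"
      using s c by (intro mult_mono) (auto simp: s_def)
    also have "\<dots> = e0 / 2" by (rule q)
    finally have "(sqrt c * s)\<^sup>2 \<le> (e0 / 2)\<^sup>2" using s c by (intro power_mono) auto
    then show ?thesis using c by (simp add: power_mult_distrib power_divide)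
  qed
  from tendstoD[OF R s] sym show "\<forall>\<^sub>F t in F. dist (fun_calc g (R t)) (fun_calc g P) < e0"
  proof eventually_elim
    case (elim t)
    obtain W :: "real^'d^'d" and m where W: "eigenframe W m (R t)" using spectral_theorem[OF elim(2)] .
    define G where "G = transpose U ** W"
    have fG: "orthonormal_frame G" using U W by (auto simp: G_def eigenframe_def intro: frame_mult frame_transpose)
    have nPR: "(norm (P - R t))\<^sup>2 = (\<Sum>i\<in>UNIV. \<Sum>j\<in>UNIV. (l i - m j)\<^sup>2 * (G $ i $ j)\<^sup>2)"
      using mixed_frame_norm[OF U W, of "\<lambda>x. x" "\<lambda>x. x"] U W by (simp add: eigenframe_def G_def)
    have small: "norm (P - R t) < s" using elim(1) by (simp add: dist_norm norm_minus_commute)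
    \<comment> \<open>The squared overlaps with a fixed column of \<open>W\<close> sum to 1, so an eigenvalue of \<open>R t\<close> far from the whole
      spectrum of \<open>P\<close> would make \<open>|P - R t|\<close> large.\<close>
    have near: "\<exists>k. \<bar>m j - l k\<bar> < r" for j
    proof (rule ccontr)
      assume "\<nexists>k. \<bar>m j - l k\<bar> < r"
      then have far: "r\<^sup>2 \<le> (l k - m j)\<^sup>2" for k
        using r by (metis abs_ge_self abs_minus_commute less_imp_le not_le power2_abs power_mono)
      have "r\<^sup>2 = (\<Sum>i\<in>UNIV. r\<^sup>2 * (G $ i $ j)\<^sup>2)"
        using frame_column_sum[OF fG] by (simp flip: sum_distrib_left)
      also have "\<dots> \<le> (\<Sum>i\<in>UNIV. (l i - m j)\<^sup>2 * (G $ i $ j)\<^sup>2)"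
        using far by (intro sum_mono mult_right_mono) auto
      also have "\<dots> \<le> (norm (P - R t))\<^sup>2" unfolding nPR
        by (intro sum_mono) (rule member_le_sum, auto)
      also have "\<dots> < s\<^sup>2" using small by (intro power_strict_mono) auto
      also have "\<dots> \<le> r\<^sup>2" using s by (intro power_mono) (auto simp: s_def)
      finally show False by simp
    qed
    have bound: "(g (l i) - g (m j))\<^sup>2 \<le> e\<^sup>2 + c * (l i - m j)\<^sup>2" for i j
    proof (cases "\<bar>m j - l i\<bar> < r")
      case True
      then have "\<bar>g (m j) - g (l i)\<bar> < e" using d(2) r(2) less_le_trans by blast
      then have "(g (l i) - g (m j))\<^sup>2 \<le> e\<^sup>2"
        by (metis abs_ge_zero abs_minus_commute less_imp_le power2_abs power_mono)
      then show ?thesis using c by (simp add: add_increasing2)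
    next
      case False
      obtain k where "\<bar>m j - l k\<bar> < r" using near by blast
      then have "\<bar>g (m j) - g (l k)\<bar> < e" using d(2) r(2) less_le_trans by blast
      then have "\<bar>g (l i) - g (m j)\<bar> \<le> M" using M[of i k] by linarith
      then have "(g (l i) - g (m j))\<^sup>2 \<le> M\<^sup>2"
        by (metis abs_ge_zero power2_abs power_mono)
      also have "M\<^sup>2 = c * r\<^sup>2" using r by (simp add: c_def power_divide)
      also have "\<dots> \<le> c * (l i - m j)\<^sup>2"
        using False r c by (intro mult_left_mono) (metis abs_minus_commute less_imp_le not_le power2_abs power_mono, simp)
      finally show ?thesis by (simp add: add_increasing)
    qed
    have "(norm (fun_calc g P - fun_calc g (R t)))\<^sup>2 = (\<Sum>i\<in>UNIV. \<Sum>j\<in>UNIV. (g (l i) - g (m j))\<^sup>2 * (G $ i $ j)\<^sup>2)"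
      unfolding fun_calc_eigenframe[OF U] fun_calc_eigenframe[OF W] mixed_frame_norm[OF U W] G_def ..
    also have "\<dots> \<le> (\<Sum>i\<in>UNIV. \<Sum>j\<in>UNIV. (e\<^sup>2 + c * (l i - m j)\<^sup>2) * (G $ i $ j)\<^sup>2)"
      by (intro sum_mono mult_right_mono bound) auto
    also have "\<dots> = e\<^sup>2 * (\<Sum>i\<in>UNIV. \<Sum>j\<in>UNIV. (G $ i $ j)\<^sup>2) + c * (norm (P - R t))\<^sup>2"
      unfolding nPR by (simp add: distrib_right sum.distrib sum_distrib_left mult.assoc)
    also have "(\<Sum>i\<in>UNIV. \<Sum>j\<in>UNIV. (G $ i $ j)\<^sup>2) = (\<Sum>j\<in>UNIV. \<Sum>i\<in>UNIV. (G $ i $ j)\<^sup>2)"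
      by (rule sum.swap)
    also have "e\<^sup>2 * \<dots> + c * (norm (P - R t))\<^sup>2 = real CARD('d) * e\<^sup>2 + c * (norm (P - R t))\<^sup>2"
      using frame_column_sum[OF fG] by simp
    also have "\<dots> \<le> e0\<^sup>2 / 4 + c * s\<^sup>2"
      unfolding e_card using small c by (intro add_left_mono mult_left_mono power_mono) auto
    also have "\<dots> \<le> e0\<^sup>2 / 4 + e0\<^sup>2 / 4" using cs by simp
    also have "\<dots> < e0\<^sup>2" using e0 by simp
    finally have "norm (fun_calc g P - fun_calc g (R t)) < e0"
      using e0 by (simp add: power2_less_imp_less)
    then show ?case by (simp add: dist_norm norm_minus_commute)
  qed
qed

definition divided_difference :: "(real \<Rightarrow> real) \<Rightarrow> (real \<Rightarrow> real) \<Rightarrow> real \<Rightarrow> real \<Rightarrow> real" where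
  "divided_difference f f' x y = (if y = x then f' x else (f y - f x) / (y - x))"

text \<open>The entrywise (Schur) product with \<open>k\<close> in the coordinates given by \<open>U\<close>.\<close>

definition schur_frame :: "real^'n^'d \<Rightarrow> ('n \<Rightarrow> 'n \<Rightarrow> real) \<Rightarrow> real^'d^'d \<Rightarrow> real^'d^'d" where
  "schur_frame U k X = U ** (\<chi> i j. k i j * (transpose U ** X ** U) $ i $ j) ** transpose U"

lemma isCont_divided_difference:
  assumes f: "\<And>z. z \<in> {x, y} \<Longrightarrow> (f has_real_derivative f' z) (at z)"
  shows "isCont (divided_difference f f' x) y"
proof (cases "y = x")
  case True
  have "((\<lambda>z. (f z - f x) / (z - x)) \<longlongrightarrow> f' x) (at x)"
    using f[of x] by (simp add: has_field_derivative_iff)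
  then have "((\<lambda>z. divided_difference f f' x z) \<longlongrightarrow> f' x) (at x)"
    by (rule Lim_transform_eventually) (simp add: divided_difference_def eventually_at_filter)
  moreover have "divided_difference f f' x x = f' x" by (simp add: divided_difference_def)
  ultimately show ?thesis using True by (simp add: isCont_def)
next
  case False
  have "isCont f y" using f[of y] DERIV_isCont by blast
  then have "isCont (\<lambda>z. (f z - f x) / (z - x)) y"
    using False by (intro continuous_intros) auto
  moreover have "\<forall>\<^sub>F z in nhds y. (f z - f x) / (z - x) = divided_difference f f' x z"
    using t1_space_nhds[OF False] by eventually_elim (simp add: divided_difference_def)
  ultimately show ?thesis by (simp add: isCont_cong)
qed

lemma fun_calc_mult:
  fixes P :: "real^'d^'d"
  assumes "transpose P = P"
  shows "fun_calc f P ** fun_calc g P = fun_calc (\<lambda>x. f x * g x) P"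
proof -
  obtain U :: "real^'d^'d" and l where U: "eigenframe U l P" using spectral_theorem[OF assms] .
  show ?thesis
    using eigenframe_mult[OF eigenframe_fun_calc[OF U] eigenframe_fun_calc[OF U], of f g]
    by (simp add: fun_calc_eigenframe[OF U])
qed

lemma fun_calc_shift:
  fixes P :: "real^'d^'d"
  assumes "transpose P = P"
  shows "fun_calc (\<lambda>x. f x - c) P = fun_calc f P - mat c"
proof -
  obtain U :: "real^'d^'d" and l where U: "eigenframe U l P" using spectral_theorem[OF assms] .
  have fU: "orthonormal_frame U" using U by (simp add: eigenframe_def)
  have "diag_mat (\<lambda>i. f (l i) - c) = diag_mat (\<lambda>i. f (l i)) - c *\<^sub>R mat 1"
    by (auto simp: diag_mat_def mat_def vec_eq_iff)
  moreover have "(mat c :: real^'d^'d) = c *\<^sub>R mat 1" by (auto simp: mat_def vec_eq_iff)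
  ultimately show ?thesis
    using frame_cancel[OF fU]
    by (simp add: fun_calc_eigenframe[OF U] matrix_mult.diff_left matrix_mult.diff_right
        matrix_mult.scaleR_left matrix_mult.scaleR_right)
qed

lemma fun_calc_id:
  fixes P :: "real^'d^'d"
  assumes "transpose P = P" shows "fun_calc (\<lambda>x. x) P = P"
proof -
  obtain U :: "real^'d^'d" and l where U: "eigenframe U l P" using spectral_theorem[OF assms] .
  then show ?thesis by (simp add: fun_calc_eigenframe[OF U]) (simp add: eigenframe_def)
qed

lemma mult_frame_column:
  assumes U: "eigenframe U l P"
  shows "(fun_calc f P ** U) $ k $ i = f (l i) * U $ k $ i"
proof -
  have "fun_calc f P ** U = U ** diag_mat (\<lambda>i. f (l i))"
    using eigenframe_frame[OF U] by (simp add: fun_calc_eigenframe[OF U] frame_cancel)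
  then show ?thesis by (simp add: mult_diag_mat_nth mult.commute)
qed

text \<open>An exact, linear formula for the increment of a matrix function on an eigenvector of the base point:
with \<open>g\<close> the difference quotient of \<open>f\<close> at the eigenvalue, \<open>f(R) - f(l\<^sub>i) = g(R) (R - l\<^sub>i)\<close>. It
reduces differentiability of the calculus to its continuity.\<close>

lemma fun_calc_increment:
  fixes P :: "real^'d^'d"
  assumes U: "eigenframe U l P" and R: "transpose R = R"
    and f: "\<And>y. g y * (y - l i) = f y - f (l i)"
  shows "((fun_calc f R - fun_calc f P) ** U) $ k $ i = (fun_calc g R ** (R - P) ** U) $ k $ i"
proof -
  have P: "transpose P = P" using eigenframe_symmetric[OF U] .
  have col: "(mat c ** U) $ k $ i = c * U $ k $ i" for c k
    using diag_mat_mult_nth[of "\<lambda>_. c"] by (simp add: diag_mat_const)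
  have PU: "(P ** U) $ k $ i = (mat (l i) ** U) $ k $ i" for k
    using mult_frame_column[OF U, of "\<lambda>x. x"] by (simp add: fun_calc_id[OF P] col)
  have fPU: "(fun_calc f P ** U) $ k $ i = (mat (f (l i)) ** U) $ k $ i" for k
    using mult_frame_column[OF U, of f] by (simp add: col)
  have split: "(X ** Y ** U) $ k $ i = (\<Sum>q\<in>UNIV. X $ k $ q * (Y ** U) $ q $ i)" for X Y :: "real^'d^'d"
    by (simp add: matrix_mul_assoc[symmetric]) (simp add: matrix_matrix_mult_def)
  have "((fun_calc f R - fun_calc f P) ** U) $ k $ i = ((fun_calc f R - mat (f (l i))) ** U) $ k $ i"
    by (simp add: matrix_mult.diff_left fPU)
  also have "fun_calc f R - mat (f (l i)) = fun_calc g R ** (R - mat (l i))"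
    using fun_calc_mult[OF R, of g "\<lambda>y. y - l i"] by (simp add: f fun_calc_shift[OF R] fun_calc_id[OF R])
  also have "(fun_calc g R ** (R - mat (l i)) ** U) $ k $ i = (fun_calc g R ** (R - P) ** U) $ k $ i"
    unfolding split by (simp add: matrix_mult.diff_left PU)
  finally show ?thesis .
qed

lemma has_vector_derivative_iff_quotient:
  fixes c :: "real \<Rightarrow> 'a::real_normed_vector"
  shows "(c has_vector_derivative v) (at x) \<longleftrightarrow> ((\<lambda>t. (1 / (t - x)) *\<^sub>R (c t - c x)) \<longlongrightarrow> v) (at x)"
proof -
  have "(c has_vector_derivative v) (at x) \<longleftrightarrow>
    ((\<lambda>y. norm (c y - c x - (y - x) *\<^sub>R v) / norm (y - x)) \<longlongrightarrow> 0) (at x)"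
    by (simp add: has_vector_derivative_def has_derivative_iff_norm bounded_linear_scaleR_left)
  also have "\<dots> \<longleftrightarrow> ((\<lambda>y. norm ((1 / (y - x)) *\<^sub>R (c y - c x) - v)) \<longlongrightarrow> 0) (at x)"
  proof (rule filterlim_cong[OF refl refl])
    show "\<forall>\<^sub>F y in at x. norm (c y - c x - (y - x) *\<^sub>R v) / norm (y - x) = norm ((1 / (y - x)) *\<^sub>R (c y - c x) - v)"
      unfolding eventually_at_filter
    proof (intro always_eventually allI impI)
      fix y assume "y \<noteq> x"
      then have "(1 / (y - x)) *\<^sub>R (c y - c x) - v = (1 / (y - x)) *\<^sub>R (c y - c x - (y - x) *\<^sub>R v)"
        by (simp add: scaleR_diff_right)
      then show "norm (c y - c x - (y - x) *\<^sub>R v) / norm (y - x) = norm ((1 / (y - x)) *\<^sub>R (c y - c x) - v)"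
        by simp
    qed
  qed
  also have "\<dots> \<longleftrightarrow> ((\<lambda>t. (1 / (t - x)) *\<^sub>R (c t - c x)) \<longlongrightarrow> v) (at x)"
    by (simp add: tendsto_norm_zero_iff LIM_zero_iff)
  finally show ?thesis .
qed

text \<open>The Daletskii-Krein formula along a curve. Only differentiability of the curve at time 0 is available, as in
the definition of tangent vectors.\<close>

theorem fun_calc_has_vector_derivative:
  fixes P :: "real^'d^'d" and U :: "real^'d^'d"
  assumes U: "eigenframe U l P" and f: "\<And>i. (f has_real_derivative f' (l i)) (at (l i))"
    and c: "(c has_vector_derivative v) (at 0)" "c 0 = P"
    and sym: "\<forall>\<^sub>F t in nhds 0. transpose (c t) = c t"
  shows "((\<lambda>t. fun_calc f (c t)) has_vector_derivative
      schur_frame U (\<lambda>i j. divided_difference f f' (l j) (l i)) v) (at (0::real))"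
proof -
  define g where "g j = divided_difference f f' (l j)" for j
  have fU: "orthonormal_frame U" using U by (simp add: eigenframe_def)
  have g: "g j y * (y - l j) = f y - f (l j)" for j y
    by (simp add: g_def divided_difference_def)
  have lim_c: "(c \<longlongrightarrow> P) (at 0)"
    using c has_vector_derivative_continuous isCont_def by blast
  have symat: "\<forall>\<^sub>F t in at 0. transpose (c t) = c t"
    using sym by (simp add: eventually_nhds_conv_at)
  have lim_q: "((\<lambda>t. (1 / t) *\<^sub>R (c t - P)) \<longlongrightarrow> v) (at 0)"
    using c by (simp add: has_vector_derivative_iff_quotient)
  have lim_g: "((\<lambda>t. fun_calc (g j) (c t)) \<longlongrightarrow> fun_calc (g j) P) (at 0)" for j
    by (rule fun_calc_tendsto[OF U _ lim_c symat])
      (unfold g_def, rule isCont_divided_difference, use f in auto)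
  define D where "D t = (1 / t) *\<^sub>R (fun_calc f (c t) - fun_calc f P)" for t
  define E where "E = (\<chi> i j. g j (l i) * (transpose U ** v ** U) $ i $ j)"
  have "((\<lambda>t. (D t ** U) $ k $ j) \<longlongrightarrow> (U ** E) $ k $ j) (at 0)" for k j
  proof -
    have "((\<lambda>t. (fun_calc (g j) (c t) ** ((1 / t) *\<^sub>R (c t - P)) ** U) $ k $ j)
        \<longlongrightarrow> (fun_calc (g j) P ** v ** U) $ k $ j) (at 0)"
      by (intro tendsto_intros matrix_mult.tendsto lim_g lim_q)
    moreover have "\<forall>\<^sub>F t in at 0. (fun_calc (g j) (c t) ** ((1 / t) *\<^sub>R (c t - P)) ** U) $ k $ j = (D t ** U) $ k $ j"
      using symat
    proof eventually_elim
      case (elim t)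
      then show ?case
        using fun_calc_increment[OF U elim g[of j], of k]
        by (simp add: D_def matrix_mult.scaleR_left matrix_mult.scaleR_right)
    qed
    moreover have "(fun_calc (g j) P ** v ** U) $ k $ j = (U ** E) $ k $ j"
    proof -
      have "fun_calc (g j) P ** v ** U = U ** (diag_mat (\<lambda>i. g j (l i)) ** (transpose U ** v ** U))"
        by (simp add: fun_calc_eigenframe[OF U] matrix_mul_assoc)
      moreover have "(diag_mat (\<lambda>i. g j (l i)) ** (transpose U ** v ** U)) $ q $ j = E $ q $ j" for q
        by (simp add: diag_mat_mult_nth E_def)
      moreover have "(U ** X) $ k $ j = (\<Sum>q\<in>UNIV. U $ k $ q * X $ q $ j)" for X :: "real^'d^'d"
        by (simp add: matrix_matrix_mult_def)
      ultimately show ?thesis by simp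
    qed
    ultimately show ?thesis by (simp add: Lim_transform_eventually)
  qed
  then have "((\<lambda>t. D t ** U) \<longlongrightarrow> U ** E) (at 0)" by (intro vec_tendstoI)
  then have "((\<lambda>t. D t ** U ** transpose U) \<longlongrightarrow> U ** E ** transpose U) (at 0)"
    by (rule matrix_mult.tendsto[OF _ tendsto_const])
  then have "(D \<longlongrightarrow> U ** E ** transpose U) (at 0)" by (simp add: frame_cancel[OF fU])
  then show ?thesis
    using c by (simp add: has_vector_derivative_iff_quotient D_def[abs_def] E_def schur_frame_def g_def)
qed

section \<open>Divided differences of x ln x and the function psi\<close>

lemma psi_minus: "psi (- s) = psi s"
  by (simp add: psi_def)

text \<open>The derivative of \<open>s coth s\<close> is \<open>(sinh s cosh s - s) / sinh\<^sup>2 s\<close>, which is nonnegative since \<open>sinh s \<ge> s\<close>.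
The value at 0 is compared separately through \<open>s cosh s \<ge> sinh s\<close>.\<close>

lemma psi_nonneg_mono:
  assumes "0 \<le> s" "s \<le> t"
  shows "psi s \<le> psi t"
proof -
  have sinh_ge: "x \<le> sinh x" if "x \<ge> 0" for x :: real
  proof -
    have "sinh 0 - 0 \<le> sinh x - x"
    proof (rule DERIV_nonneg_imp_nondecreasing[of 0 x "\<lambda>x. sinh x - x"])
      fix y :: real
      have "((\<lambda>x. sinh x - x) has_real_derivative (cosh y - 1)) (at y)"
        by (auto intro!: derivative_eq_intros)
      then show "\<exists>z. ((\<lambda>x. sinh x - x) has_real_derivative z) (at y) \<and> 0 \<le> z"
        using cosh_real_ge_1[of y] by (intro exI[of _ "cosh y - 1"]) simp
    qed (use that in simp)
    then show ?thesis by simp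
  qed
  have pos: "psi s \<le> psi t" if "0 < s" "s \<le> t" for s t
  proof -
    have "s * (cosh s / sinh s) \<le> t * (cosh t / sinh t)"
    proof (rule DERIV_nonneg_imp_nondecreasing[of s t "\<lambda>x. x * (cosh x / sinh x)"])
      fix x assume "s \<le> x" "x \<le> t"
      then have x: "x > 0" using that by simp
      then have sp: "sinh x > 0" by simp
      have "x \<le> sinh x * 1" using sinh_ge[of x] x by simp
      also have "\<dots> \<le> sinh x * cosh x" using sp cosh_real_ge_1[of x] by (intro mult_left_mono) auto
      finally have ge: "x \<le> sinh x * cosh x" .
      have "((\<lambda>x. x * (cosh x / sinh x)) has_real_derivative
        (cosh x / sinh x + x * ((sinh x * sinh x - cosh x * cosh x) / (sinh x * sinh x)))) (at x)"
        using sp by (auto intro!: derivative_eq_intros simp: field_simps)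
      moreover have "cosh x / sinh x + x * ((sinh x * sinh x - cosh x * cosh x) / (sinh x * sinh x))
         = (sinh x * cosh x - x) / (sinh x * sinh x)"
      proof -
        have eq: "sinh x * sinh x - cosh x * cosh x = -1"
          using hyperbolic_pythagoras[of x] by (simp add: power2_eq_square)
        show ?thesis unfolding eq using sp by (simp add: field_simps)
      qed
      ultimately show "\<exists>y. ((\<lambda>x. x * (cosh x / sinh x)) has_real_derivative y) (at x) \<and> 0 \<le> y"
        using ge sp by (metis diff_ge_0_iff_ge divide_nonneg_pos mult_pos_pos)
    qed (use that in auto)
    then show ?thesis using that by (simp add: psi_def)
  qed
  have ge1: "1 \<le> psi t" if "t > 0" for t
  proof -
    have "0 * cosh 0 - sinh 0 \<le> t * cosh t - sinh t"
    proof (rule DERIV_nonneg_imp_nondecreasing[of 0 t "\<lambda>x. x * cosh x - sinh x"])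
      fix y :: real assume "0 \<le> y"
      have "((\<lambda>x. x * cosh x - sinh x) has_real_derivative (y * sinh y)) (at y)"
        by (auto intro!: derivative_eq_intros)
      then show "\<exists>z. ((\<lambda>x. x * cosh x - sinh x) has_real_derivative z) (at y) \<and> 0 \<le> z"
        using \<open>0 \<le> y\<close> by (intro exI[of _ "y * sinh y"]) simp
    qed (use that in simp)
    then show ?thesis using that by (simp add: psi_def field_simps)
  qed
  show ?thesis
  proof (cases "s = 0")
    case True
    then show ?thesis using ge1[of t] assms by (cases "t = 0") (auto simp: psi_def)
  qed (use pos assms in auto)
qed

text \<open>Write \<open>x = a + b\<close>, \<open>y = a - b\<close>; a common factor \<open>e\<^sup>a\<close> cancels and \<open>b coth b\<close> is left beside the
mean \<open>a\<close>.\<close>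

lemma xexp_divided_difference:
  fixes x y :: real
  assumes "x \<noteq> y"
  shows "(exp x * x - exp y * y) / (exp x - exp y) - (x + y) / 2 = psi ((x - y) / 2)"
proof -
  define a b where "a = (x + y) / 2" and "b = (x - y) / 2"
  have xy: "x = a + b" "y = a - b" by (simp_all add: a_def b_def field_simps)
  have b: "b \<noteq> 0" using assms by (simp add: b_def)
  then have sb: "sinh b \<noteq> 0" by simp
  have e: "exp x - exp y = exp a * (2 * sinh b)" "exp x + exp y = exp a * (2 * cosh b)"
    by (simp_all add: xy sinh_field_def cosh_field_def exp_add exp_diff exp_minus field_simps)
  have "exp x * x - exp y * y = a * (exp x - exp y) + b * (exp x + exp y)"
    by (simp add: xy algebra_simps)
  then have "(exp x * x - exp y * y) / (exp x - exp y) = a + b * (exp x + exp y) / (exp x - exp y)"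
    using assms by (simp add: add_divide_distrib)
  also have "b * (exp x + exp y) / (exp x - exp y) = b * (cosh b / sinh b)"
    unfolding e using sb by simp
  finally show ?thesis using b by (simp add: psi_def a_def b_def)
qed

definition xlnx :: "real \<Rightarrow> real" where "xlnx x = x * ln x"

lemma xlnx_deriv: "x > 0 \<Longrightarrow> (xlnx has_real_derivative (1 + ln x)) (at x)"
  unfolding xlnx_def[abs_def] by (auto intro!: derivative_eq_intros)

lemma divided_difference_xlnx:
  assumes "x > 0" "y > 0"
  shows "divided_difference xlnx (\<lambda>z. 1 + ln z) y x = psi ((ln x - ln y) / 2) + (ln x + ln y) / 2"
proof (cases "x = y")
  case True
  then show ?thesis by (simp add: divided_difference_def psi_def)
next
  case False
  then have "ln x \<noteq> ln y" using assms by simp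
  from xexp_divided_difference[OF this] show ?thesis using False assms
    by (simp add: divided_difference_def xlnx_def)
qed

section \<open>Gradient and Hessian of the squared distance on the cone\<close>

lemma ai_metric_eigenframe:
  assumes U: "eigenframe U l P" and l: "\<And>i. l i \<noteq> 0"
  shows "ai_metric P X Y = (\<Sum>i\<in>UNIV. \<Sum>j\<in>UNIV.
    (transpose U ** X ** U) $ i $ j * (transpose U ** Y ** U) $ j $ i / (l i * l j))"
proof -
  define D where "D = diag_mat (\<lambda>i. inverse (l i))"
  have "matrix_inv P = U ** D ** transpose U"
    using matrix_inv_eigenframe[OF U l] by (simp add: eigenframe_def D_def)
  then have "ai_metric P X Y = trace (U ** (D ** transpose U ** X ** U ** D ** transpose U ** Y))"
    by (simp add: ai_metric_def matrix_mul_assoc)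
  also have "\<dots> = trace ((D ** (transpose U ** X ** U)) ** (D ** (transpose U ** Y ** U)))"
    by (subst trace_mul_sym) (simp add: matrix_mul_assoc)
  also have "\<dots> = (\<Sum>i\<in>UNIV. \<Sum>j\<in>UNIV. (inverse (l i) * (transpose U ** X ** U) $ i $ j)
      * (inverse (l j) * (transpose U ** Y ** U) $ j $ i))"
    unfolding D_def trace_def by (subst matrix_matrix_mult_def) (simp add: diag_mat_mult_nth)
  finally show ?thesis by (simp add: field_simps)
qed

lemma conjugate_symmetric_nth:
  fixes U :: "real^'n^'d"
  shows "transpose X = X \<Longrightarrow> (transpose U ** X ** U) $ i $ j = (transpose U ** X ** U) $ j $ i"
proof -
  assume "transpose X = X"
  then have "transpose (transpose U ** X ** U) = transpose U ** X ** U"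
    by (simp add: matrix_transpose_mul matrix_mul_assoc)
  then show ?thesis by (metis (no_types, lifting) transpose_def vec_lambda_beta)
qed

lemma ai_metric_self_eigenframe:
  assumes U: "eigenframe U l P" and l: "\<And>i. l i \<noteq> 0" and X: "transpose X = X"
  shows "ai_metric P X X = (\<Sum>i\<in>UNIV. \<Sum>j\<in>UNIV. ((transpose U ** X ** U) $ i $ j)\<^sup>2 / (l i * l j))"
  unfolding ai_metric_eigenframe[OF U l] using conjugate_symmetric_nth[OF X, of U]
  by (intro sum.cong refl) (simp add: power2_eq_square)

text \<open>Definiteness is what makes gradients, and with them Hessians, unique.\<close>

lemma ai_metric_definite:
  assumes P: "P \<in> spd" and X: "transpose X = X" and 0: "ai_metric P X X = 0"
  shows "X = 0"
proof -
  obtain U :: "real^'a^'a" and l where U: "eigenframe U l P" "\<And>i. l i > 0"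
    using spd_eigenframe[OF P] by blast
  have l0: "l i \<noteq> 0" for i using U(2)[of i] by simp
  let ?Y = "transpose U ** X ** U"
  have nn: "0 \<le> (?Y $ i $ j)\<^sup>2 / (l i * l j)" for i j using U(2)[of i] U(2)[of j] by simp
  have "(\<Sum>i\<in>UNIV. \<Sum>j\<in>UNIV. (?Y $ i $ j)\<^sup>2 / (l i * l j)) = 0"
    using 0 ai_metric_self_eigenframe[OF U(1) l0 X] by simp
  then have "(\<Sum>j\<in>UNIV. (?Y $ i $ j)\<^sup>2 / (l i * l j)) = 0" for i
    by (subst (asm) sum_nonneg_eq_0_iff) (auto intro!: sum_nonneg nn)
  then have "(?Y $ i $ j)\<^sup>2 / (l i * l j) = 0" for i j
    by (subst (asm) sum_nonneg_eq_0_iff) (auto intro!: nn)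
  then have "?Y = 0" using l0 by (simp add: vec_eq_iff)
  moreover have "X = U ** ?Y ** transpose U"
    by (simp add: matrix_mul_assoc frame_cancel[OF eigenframe_frame[OF U(1)]])
  ultimately show ?thesis by simp
qed

lemma ai_metric_diff_left: "ai_metric P (X - Y) Z = ai_metric P X Z - ai_metric P Y Z"
  and ai_metric_scaleR_left: "ai_metric P (c *\<^sub>R X) Z = c * ai_metric P X Z"
  by (simp_all add: ai_metric_def matrix_mult.diff_left matrix_mult.diff_right trace_sub
     matrix_mult.scaleR_left matrix_mult.scaleR_right trace_scaleR)

lemma matrix_inv_spd:
  assumes "P \<in> spd"
  shows "P ** matrix_inv P = mat 1" "matrix_inv P ** P = mat 1"
    "transpose (matrix_inv P) = matrix_inv P"
proof -
  obtain U :: "real^'a^'a" and l where U: "eigenframe U l P" "\<And>i. l i > 0"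
    using spd_eigenframe[OF assms] by blast
  have l0: "l i \<noteq> 0" for i using U(2)[of i] by simp
  note V = matrix_inv_eigenframe[OF U(1) l0]
  show "P ** matrix_inv P = mat 1" "matrix_inv P ** P = mat 1"
    using eigenframe_mult[OF U(1) V] eigenframe_mult[OF V U(1)] eigenframe_frame[OF U(1)] l0
    by (simp_all add: diag_mat_const frame_cancel)
  show "transpose (matrix_inv P) = matrix_inv P" using eigenframe_symmetric[OF V] .
qed

text \<open>The gradient field \<open>P log P\<close> is itself a matrix function, which makes the derivative formula applicable to
it.\<close>

lemma fun_calc_xlnx:
  assumes "P \<in> spd"
  shows "fun_calc xlnx P = P ** mat_log P" "fun_calc xlnx P = mat_log P ** P"
proof -
  have s: "transpose P = P" using assms by (rule spd_symmetric)
  show "fun_calc xlnx P = P ** mat_log P"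
    using fun_calc_mult[OF s, of "\<lambda>x. x" ln]
    by (simp add: fun_calc_id[OF s] mat_log_eq_fun_calc[OF assms] xlnx_def[abs_def])
  show "fun_calc xlnx P = mat_log P ** P"
    using fun_calc_mult[OF s, of ln "\<lambda>x. x"]
    by (simp add: fun_calc_id[OF s] mat_log_eq_fun_calc[OF assms] xlnx_def[abs_def] mult.commute)
qed

lemma mat_log_symmetric: "P \<in> spd \<Longrightarrow> transpose (mat_log P) = mat_log P"
  using eigenframe_fun_calc eigenframe_symmetric mat_log_eq_fun_calc spd_eigenframe by metis

lemma mat_log_has_vector_derivative:
  fixes P :: "real^'d^'d" and U :: "real^'d^'d"
  assumes U: "eigenframe U l P" and l: "\<And>i. l i > 0"
    and c: "(c has_vector_derivative v) (at 0)" "c 0 = P" and spd: "\<forall>\<^sub>F t in nhds 0. c t \<in> spd"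
  shows "((\<lambda>t. mat_log (c t)) has_vector_derivative
     schur_frame U (\<lambda>i j. divided_difference ln inverse (l j) (l i)) v) (at (0::real))"
proof -
  have "((\<lambda>t. fun_calc ln (c t)) has_vector_derivative
     schur_frame U (\<lambda>i j. divided_difference ln inverse (l j) (l i)) v) (at 0)"
  proof (rule fun_calc_has_vector_derivative[OF U _ c])
    show "(ln has_real_derivative inverse (l i)) (at (l i))" for i
      using l[of i] by (auto intro!: derivative_eq_intros simp: divide_inverse)
    show "\<forall>\<^sub>F t in nhds 0. transpose (c t) = c t"
      using spd by eventually_elim (rule spd_symmetric)
  qed
  moreover have "\<forall>\<^sub>F t in nhds 0. fun_calc ln (c t) = mat_log (c t)"
    using spd by eventually_elim (simp add: mat_log_eq_fun_calc)
  ultimately show ?thesis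
    by (subst (asm) has_vector_derivative_cong_ev[where g = "\<lambda>t. mat_log (c t)"])
      (auto dest: eventually_nhds_x_imp_x)
qed

text \<open>In \<open>\<langle>log P, D log(v)\<rangle>\<close> only the diagonal divided differences \<open>1 / l\<^sub>i\<close> survive, because \<open>log P\<close> is diagonal in the
eigenframe; the result is the metric product of \<open>P log P\<close> with \<open>v\<close>.\<close>

lemma fiber_objective_has_derivative:
  fixes P :: "real^'d^'d"
  assumes P: "P \<in> spd" and c: "(c has_vector_derivative v) (at 0)" "c 0 = P"
    and spd: "\<forall>\<^sub>F t in nhds 0. c t \<in> spd"
  shows "((\<lambda>t. fiber_objective (c t)) has_real_derivative ai_metric P (fun_calc xlnx P) v) (at (0::real))"
proof -
  obtain U :: "real^'d^'d" and l where U: "eigenframe U l P" and l: "\<And>i. l i > 0"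
    using spd_eigenframe[OF P] by blast
  have l0: "l i \<noteq> 0" for i using l[of i] by simp
  let ?k = "\<lambda>i j. divided_difference ln inverse (l j) (l i)"
  let ?Y = "transpose U ** v ** U"
  note cancel = frame_cancel[OF eigenframe_frame[OF U]]
  have "((\<lambda>t. (1/2) * (mat_log (c t) \<bullet> mat_log (c t))) has_real_derivative
     mat_log P \<bullet> schur_frame U ?k v) (at 0)"
    using bounded_bilinear.has_vector_derivative[OF bounded_bilinear_inner
         mat_log_has_vector_derivative[OF U l c spd] mat_log_has_vector_derivative[OF U l c spd]]
    by (auto simp: has_real_derivative_iff_has_vector_derivative c(2) inner_commute
      dest: bounded_linear.has_vector_derivative[OF bounded_linear_mult_right[of "1/2"]])
  moreover have "mat_log P \<bullet> schur_frame U ?k v = ai_metric P (fun_calc xlnx P) v"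
  proof -
    have "mat_log P \<bullet> schur_frame U ?k v = trace (mat_log P ** schur_frame U ?k v)"
      by (simp add: inner_matrix_eq_trace mat_log_symmetric[OF P])
    also have "mat_log P ** schur_frame U ?k v =
       U ** (diag_mat (\<lambda>i. ln (l i)) ** (\<chi> i j. ?k i j * ?Y $ i $ j)) ** transpose U"
      by (simp add: schur_frame_def mat_log_eigenframe[OF U l] matrix_mul_assoc cancel)
    also have "trace \<dots> = trace (diag_mat (\<lambda>i. ln (l i)) ** (\<chi> i j. ?k i j * ?Y $ i $ j))"
      by (rule frame_trace[OF eigenframe_frame[OF U]])
    also have "\<dots> = (\<Sum>i\<in>UNIV. ln (l i) * ?Y $ i $ i / l i)"
      by (simp add: trace_def diag_mat_mult_nth divided_difference_def field_simps)
    also have "\<dots> = trace (diag_mat (\<lambda>i. ln (l i) / l i) ** ?Y)"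
      by (simp add: trace_def diag_mat_mult_nth)
    also have "\<dots> = trace (U ** diag_mat (\<lambda>i. ln (l i) / l i) ** transpose U ** v)"
      using trace_mul_sym[of U "diag_mat (\<lambda>i. ln (l i) / l i) ** transpose U ** v"]
      by (simp add: matrix_mul_assoc)
    also have "U ** diag_mat (\<lambda>i. ln (l i) / l i) ** transpose U = mat_log P ** matrix_inv P"
      using eigenframe_mult[OF eigenframe_fun_calc[OF U, of ln] matrix_inv_eigenframe[OF U l0]]
      by (simp add: mat_log_eq_fun_calc[OF P] divide_inverse)
    also have "mat_log P ** matrix_inv P = matrix_inv P ** (P ** mat_log P) ** matrix_inv P"
      by (simp add: matrix_mul_assoc matrix_inv_spd[OF P])
    finally show ?thesis by (simp add: ai_metric_def fun_calc_xlnx[OF P])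
  qed
  moreover have "fiber_objective (c t) = (1/2) * (mat_log (c t) \<bullet> mat_log (c t))" for t
    by (simp add: fiber_objective_def ai_dist_one power2_norm_eq_inner)
  ultimately show ?thesis by (simp only:)
qed

text \<open>The second summand is exactly the Christoffel correction of the affine-invariant connection applied to
\<open>P log P\<close>, so the first one is the covariant derivative.\<close>

lemma ambient_gradient_derivative:
  fixes P :: "real^'d^'d" and U :: "real^'d^'d"
  assumes U: "eigenframe U l P" and l: "\<And>i. l i > 0"
    and c: "(c has_vector_derivative v) (at 0)" "c 0 = P" and spd: "\<forall>\<^sub>F t in nhds 0. c t \<in> spd"
  shows "((\<lambda>t. fun_calc xlnx (c t)) has_vector_derivative
     (schur_frame U (\<lambda>i j. psi ((ln (l i) - ln (l j)) / 2)) v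
       + (1/2) *\<^sub>R (v ** mat_log P + mat_log P ** v))) (at (0::real))"
proof -
  note cancel = frame_cancel[OF eigenframe_frame[OF U]]
  let ?Y = "transpose U ** v ** U"
  let ?d = "\<lambda>i. ln (l i)"
  have "((\<lambda>t. fun_calc xlnx (c t)) has_vector_derivative
     schur_frame U (\<lambda>i j. divided_difference xlnx (\<lambda>z. 1 + ln z) (l j) (l i)) v) (at 0)"
  proof (rule fun_calc_has_vector_derivative[OF U _ c])
    show "\<forall>\<^sub>F t in nhds 0. transpose (c t) = c t"
      using spd by eventually_elim (rule spd_symmetric)
  qed (use l xlnx_deriv in auto)
  moreover have "schur_frame U (\<lambda>i j. divided_difference xlnx (\<lambda>z. 1 + ln z) (l j) (l i)) v =
    schur_frame U (\<lambda>i j. psi ((ln (l i) - ln (l j)) / 2)) v + (1/2) *\<^sub>R (v ** mat_log P + mat_log P ** v)"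
  proof -
    have "(\<chi> i j. divided_difference xlnx (\<lambda>z. 1 + ln z) (l j) (l i) * ?Y $ i $ j)
       = (\<chi> i j. psi ((ln (l i) - ln (l j)) / 2) * ?Y $ i $ j) + (1/2) *\<^sub>R (?Y ** diag_mat ?d + diag_mat ?d ** ?Y)"
      using l by (simp add: divided_difference_xlnx vec_eq_iff diag_mat_mult_nth mult_diag_mat_nth field_simps)
    moreover have "U ** (?Y ** diag_mat ?d) ** transpose U = v ** mat_log P"
      "U ** (diag_mat ?d ** ?Y) ** transpose U = mat_log P ** v"
      by (simp_all add: mat_log_eigenframe[OF U l] matrix_mul_assoc cancel)
    ultimately show ?thesis
      by (simp add: schur_frame_def matrix_mult.add_left matrix_mult.add_right
        matrix_mult.scaleR_left matrix_mult.scaleR_right matrix_mul_assoc)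
  qed
  ultimately show ?thesis by simp
qed

lemma schur_frame_metric:
  assumes U: "eigenframe U l P" and l: "\<And>i. l i > 0" and v: "transpose v = v"
  shows "ai_metric P (schur_frame U k v) v =
     (\<Sum>i\<in>UNIV. \<Sum>j\<in>UNIV. k i j * (((transpose U ** v ** U) $ i $ j)\<^sup>2 / (l i * l j)))"
proof -
  note cancel = frame_cancel[OF eigenframe_frame[OF U]]
  have l0: "l i \<noteq> 0" for i using l[of i] by simp
  have "transpose U ** schur_frame U k v ** U = (\<chi> i j. k i j * (transpose U ** v ** U) $ i $ j)"
    by (simp add: schur_frame_def matrix_mul_assoc cancel)
  then show ?thesis using conjugate_symmetric_nth[OF v, of U]
    by (simp add: ai_metric_eigenframe[OF U l0] power2_eq_square mult.assoc)
qed

text \<open>The extreme case of \<open>|ln l\<^sub>i - ln l\<^sub>j| \<le> sqrt 2 D\<close> is a pair of opposite logarithms carrying the whole norm.\<close>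

lemma ambient_hessian_bound:
  assumes U: "eigenframe U l P" and l: "\<And>i. l i > 0" and v: "transpose v = v"
    and D: "ai_dist (mat 1) P \<le> D"
  shows "ai_metric P (schur_frame U (\<lambda>i j. psi ((ln (l i) - ln (l j)) / 2)) v) v
     \<le> psi (D / sqrt 2) * ai_metric P v v"
proof -
  have l0: "l i \<noteq> 0" for i using l[of i] by simp
  let ?x = "\<lambda>i. ln (l i)"
  have nrm: "(\<Sum>i\<in>UNIV. (?x i)\<^sup>2) \<le> D\<^sup>2"
  proof -
    have "sqrt (\<Sum>i\<in>UNIV. (?x i)\<^sup>2) \<le> D"
      using D by (simp add: ai_dist_one mat_log_eigenframe[OF U l] norm_conj_diag[OF eigenframe_frame[OF U]])
    then show ?thesis by (rule sqrt_le_D)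
  qed
  have D0: "0 \<le> D" by (rule order_trans[OF _ D]) (simp add: ai_dist_def)
  have k: "psi ((?x i - ?x j) / 2) \<le> psi (D / sqrt 2)" for i j
  proof -
    have "(?x i - ?x j)\<^sup>2 \<le> 2 * D\<^sup>2"
    proof (cases "i = j")
      case False
      have "(?x i - ?x j)\<^sup>2 \<le> 2 * ((?x i)\<^sup>2 + (?x j)\<^sup>2)"
        using zero_le_power2[of "?x i + ?x j"] by (simp add: power2_eq_square algebra_simps)
      also have "(?x i)\<^sup>2 + (?x j)\<^sup>2 = (\<Sum>i\<in>{i,j}. (?x i)\<^sup>2)" using False by simp
      also have "\<dots> \<le> (\<Sum>i\<in>UNIV. (?x i)\<^sup>2)" by (rule sum_mono2) auto
      finally show ?thesis using nrm by linarith
    qed simp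
    then have "\<bar>?x i - ?x j\<bar> \<le> sqrt 2 * D"
      using D0 by (intro power2_le_imp_le[of "\<bar>?x i - ?x j\<bar>"]) (simp_all add: power_mult_distrib)
    moreover define q where "q = D / sqrt 2"
    moreover have "sqrt 2 * D = 2 * q"
      by (simp add: field_simps q_def)
    ultimately have "\<bar>?x i - ?x j\<bar> \<le> 2 * q" by (simp only:)
    then have "\<bar>(?x i - ?x j) / 2\<bar> \<le> q" by (simp add: abs_divide)
    then have "psi \<bar>(?x i - ?x j) / 2\<bar> \<le> psi (D / sqrt 2)"
      unfolding q_def by (intro psi_nonneg_mono) auto
    moreover have "psi \<bar>s\<bar> = psi s" for s by (cases "s \<ge> 0") (auto simp: psi_minus)
    ultimately show ?thesis by metis
  qed
  show ?thesis
    unfolding schur_frame_metric[OF U l v] ai_metric_self_eigenframe[OF U l0 v] sum_distrib_left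
    using l by (intro sum_mono mult_right_mono k divide_nonneg_nonneg) (auto simp: less_imp_le)
qed

section \<open>Tangent spaces of action fibers\<close>

text \<open>The linearised fiber equations; the last one linearises \<open>det P = 1\<close>.\<close>

definition fiber_tangent :: "real^'m^'d \<Rightarrow> real^'d^'d \<Rightarrow> (real^'d^'d) set" where
  "fiber_tangent A P = {X. transpose X = X \<and> X ** A = 0 \<and> trace (matrix_inv P ** X) = 0}"

lemma trace_mat_log: "P \<in> spd \<Longrightarrow> trace (mat_log P) = ln (det P)"
proof -
  assume "P \<in> spd"
  then obtain U :: "real^'a^'a" and l where U: "eigenframe U l P" and l: "\<And>i. l i > 0"
    using spd_eigenframe by blast
  show ?thesis
    unfolding det_eigenframe[OF U l] mat_log_eigenframe[OF U l]
    by (simp add: frame_trace[OF eigenframe_frame[OF U]] trace_diag_mat)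
qed

text \<open>Jacobi's formula for \<open>ln (det P)\<close>, obtained from the derivative of the logarithm.\<close>

lemma trace_log_has_derivative:
  fixes P :: "real^'d^'d"
  assumes P: "P \<in> spd" and c: "(c has_vector_derivative v) (at 0)" "c 0 = P"
    and spd: "\<forall>\<^sub>F t in nhds 0. c t \<in> spd"
  shows "((\<lambda>t. trace (mat_log (c t))) has_real_derivative trace (matrix_inv P ** v)) (at (0::real))"
proof -
  obtain U :: "real^'d^'d" and l where U: "eigenframe U l P" and l: "\<And>i. l i > 0"
    using spd_eigenframe[OF P] by blast
  have l0: "l i \<noteq> 0" for i using l[of i] by simp
  let ?k = "\<lambda>i j. divided_difference ln inverse (l j) (l i)"
  have "((\<lambda>t. trace (mat_log (c t))) has_real_derivative trace (schur_frame U ?k v)) (at 0)"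
    unfolding has_real_derivative_iff_has_vector_derivative
    by (rule bounded_linear.has_vector_derivative[OF bounded_linear_trace mat_log_has_vector_derivative[OF U l c spd]])
  also have "trace (schur_frame U ?k v) = trace (diag_mat (\<lambda>i. inverse (l i)) ** (transpose U ** v ** U))"
    unfolding schur_frame_def frame_trace[OF eigenframe_frame[OF U]]
    by (simp add: trace_def diag_mat_mult_nth divided_difference_def)
  also have "\<dots> = trace (matrix_inv P ** v)"
    using trace_mul_sym[of U "diag_mat (\<lambda>i. inverse (l i)) ** transpose U ** v"] matrix_inv_eigenframe[OF U l0]
    by (simp add: matrix_mul_assoc eigenframe_def)
  finally show ?thesis .
qed

lemma half_sum_cancel:
  fixes z :: "'a::real_vector"
  shows "z + (1/2) *\<^sub>R (a + b) - (y + x) - (1/2) *\<^sub>R (a - x + (b - x)) = z - y"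
proof -
  have "a - x + (b - x) = (a + b) - (x + x)" by simp
  then show ?thesis by (simp only: scaleR_diff_right scaleR_half_double) simp
qed

lemma const_on_nhds_derivative:
  fixes f :: "real \<Rightarrow> 'a::real_normed_vector"
  assumes "(f has_vector_derivative D) (at a)" "\<forall>\<^sub>F t in nhds a. f t = k"
  shows "D = 0"
proof -
  have "((\<lambda>_. k) has_vector_derivative D) (at a)"
    using assms by (subst (asm) has_vector_derivative_cong_ev[where g = "\<lambda>_. k"])
      (auto dest: eventually_nhds_x_imp_x)
  then show ?thesis using has_vector_derivative_const vector_derivative_unique_at by blast
qed

lemma diag_mat_has_vector_derivative:
  assumes "\<And>i. ((\<lambda>t. f t i) has_real_derivative f' i) (at x)"
  shows "((\<lambda>t. diag_mat (f t)) has_vector_derivative diag_mat f') (at x)"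
  unfolding has_vector_derivative_iff_quotient diag_mat_def
proof (rule vec_tendstoI, rule vec_tendstoI, goal_cases)
  case (1 i j)
  have "((\<lambda>t. (f t i - f x i) / (t - x)) \<longlongrightarrow> f' i) (at x)"
    using assms[of i] by (simp add: has_field_derivative_iff)
  then show ?case by (cases "i = j") simp_all
qed

lemma curve_velocity_in_fiber_tangent:
  fixes A :: "real^'m^'d"
  assumes P: "P \<in> action_fiber A B" and c: "curve_in (action_fiber A B) P v c"
  shows "v \<in> fiber_tangent A P"
proof -
  have cP: "c 0 = P" and ev: "\<forall>\<^sub>F t in nhds 0. c t \<in> action_fiber A B" and dv: "(c has_vector_derivative v) (at 0)"
    using c by (auto simp: curve_in_def)
  have spdP: "P \<in> spd" using P by (simp add: action_fiber_def spd1_def)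
  have ev_spd: "\<forall>\<^sub>F t in nhds 0. c t \<in> spd"
    using ev by eventually_elim (simp add: action_fiber_def spd1_def)
  have "transpose v - v = 0"
  proof (rule const_on_nhds_derivative)
    show "((\<lambda>t. transpose (c t) - c t) has_vector_derivative (transpose v - v)) (at 0)"
      by (intro has_vector_derivative_diff bounded_linear.has_vector_derivative[OF bounded_linear_transpose] dv)
    show "\<forall>\<^sub>F t in nhds 0. transpose (c t) - c t = 0"
      using ev_spd by eventually_elim (simp add: spd_symmetric)
  qed
  moreover have "v ** A = 0"
  proof (rule const_on_nhds_derivative)
    show "((\<lambda>t. c t ** A) has_vector_derivative (v ** A)) (at 0)"
      by (rule bounded_linear.has_vector_derivative[OF matrix_mult.bounded_linear_left dv])
    show "\<forall>\<^sub>F t in nhds 0. c t ** A = B"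
      using ev by eventually_elim (simp add: action_fiber_def)
  qed
  moreover have "trace (matrix_inv P ** v) = 0"
  proof (rule const_on_nhds_derivative)
    show "((\<lambda>t. trace (mat_log (c t))) has_vector_derivative trace (matrix_inv P ** v)) (at 0)"
      using trace_log_has_derivative[OF spdP dv cP ev_spd]
      by (simp add: has_real_derivative_iff_has_vector_derivative)
    show "\<forall>\<^sub>F t in nhds 0. trace (mat_log (c t)) = 0"
      using ev by eventually_elim (simp add: action_fiber_def spd1_def trace_mat_log)
  qed
  ultimately show ?thesis by (simp add: fiber_tangent_def)
qed

lemma spd_congruence:
  fixes R :: "real^'d^'d"
  assumes R: "R \<in> spd" and S: "transpose S = S" "S ** T = mat 1"
  shows "S ** R ** S \<in> spd"
  unfolding spd_def
proof (intro CollectI conjI allI impI)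
  show "transpose (S ** R ** S) = S ** R ** S"
    using R S by (simp add: matrix_transpose_mul spd_symmetric matrix_mul_assoc)
  fix x :: "real^'d" assume x: "x \<noteq> 0"
  have TS: "T ** S = mat 1" using S(2) matrix_left_right_inverse by blast
  have "S *v x \<noteq> 0"
  proof
    assume "S *v x = 0"
    then have "T *v (S *v x) = 0" by simp
    then show False using x TS by (simp add: matrix_vector_mul_assoc)
  qed
  then have "0 < (S *v x) \<bullet> (R *v (S *v x))" using R by (simp add: spd_def)
  also have "\<dots> = x \<bullet> ((S ** R ** S) *v x)"
    by (simp add: inner_symmetric_matrix[OF S(1), symmetric] matrix_vector_mul_assoc matrix_mul_assoc)
  finally show "0 < x \<bullet> ((S ** R ** S) *v x)" .
qed

text \<open>The curve is the geodesic \<open>S exp(tY) S\<close> with \<open>S = P\<^sup>1\<^sup>/\<^sup>2\<close> and \<open>Y = S\<^sup>-\<^sup>1 v S\<^sup>-\<^sup>1\<close>. It stays in the fiber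
because \<open>Y\<close> annihilates \<open>S A\<close> and has trace 0: this is the sense in which fibers are totally
geodesic.\<close>

lemma fiber_tangent_has_curve:
  fixes A :: "real^'m^'d"
  assumes P: "P \<in> action_fiber A B" and v: "v \<in> fiber_tangent A P"
  shows "\<exists>c. curve_in (action_fiber A B) P v c"
proof -
  have spdP: "P \<in> spd" and dP: "det P = 1" and PA: "P ** A = B" using P by (auto simp: action_fiber_def spd1_def)
  have vs: "transpose v = v" and vA: "v ** A = 0" and vt: "trace (matrix_inv P ** v) = 0"
    using v by (auto simp: fiber_tangent_def)
  obtain U :: "real^'d^'d" and l where U: "eigenframe U l P" and l: "\<And>i. l i > 0"
    using spd_eigenframe[OF spdP] by blast
  define S where "S = mat_sqrt P"
  define T where "T = matrix_inv S"
  have S: "eigenframe U (\<lambda>i. sqrt (l i)) S" unfolding S_def by (rule mat_sqrt_eigenframe[OF U l])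
  have sl: "sqrt (l i) \<noteq> 0" for i using l[of i] by simp
  have T: "eigenframe U (\<lambda>i. inverse (sqrt (l i))) T" unfolding T_def by (rule matrix_inv_eigenframe[OF S sl])
  have ST: "S ** T = mat 1" "T ** S = mat 1"
    using eigenframe_mult[OF S T] eigenframe_mult[OF T S] sl
    by (simp_all add: diag_mat_const frame_cancel[OF eigenframe_frame[OF U]])
  have SS: "S ** S = P" using eigenframe_mult[OF S S] l U by (simp add: eigenframe_def less_imp_le)
  have symS: "transpose S = S" and symT: "transpose T = T" using S T by (auto dest: eigenframe_symmetric)
  define Y where "Y = T ** v ** T"
  have symY: "transpose Y = Y" using vs symT by (simp add: Y_def matrix_transpose_mul matrix_mul_assoc)
  obtain W :: "real^'d^'d" and n where W: "eigenframe W n Y" using spectral_theorem[OF symY] .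
  note cW = frame_cancel[OF eigenframe_frame[OF W]]
  define E where "E t = W ** diag_mat (\<lambda>i. exp (t * n i)) ** transpose W" for t
  have E: "eigenframe W (\<lambda>i. exp (t * n i)) (E t)" for t using W by (simp add: eigenframe_def E_def)
  define c where "c t = S ** E t ** S" for t
  have trY: "(\<Sum>i\<in>UNIV. n i) = 0"
  proof -
    have "(\<Sum>i\<in>UNIV. n i) = trace Y"
      using W frame_trace[OF eigenframe_frame[OF W], of "diag_mat n"] by (simp add: eigenframe_def trace_diag_mat)
    also have "\<dots> = trace (T ** T ** v)"
      unfolding Y_def using trace_mul_sym[of T "T ** v"] trace_mul_sym[of "T ** v" T]
      by (simp add: matrix_mul_assoc)
    also have "T ** T = matrix_inv P"
    proof (rule matrix_inv_eqI[symmetric])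
      have "P ** (T ** T) = S ** (S ** T) ** T" by (simp add: SS[symmetric] matrix_mul_assoc)
      then show "P ** (T ** T) = mat 1" by (simp add: ST)
    qed
    finally show ?thesis using vt by simp
  qed
  have detE: "det (E t) = 1" for t
    using det_square_eigenframe[OF E[of t]] trY by (simp add: exp_sum[symmetric] sum_distrib_left[symmetric])
  \<comment> \<open>Since \<open>Y (S A) = 0\<close>, the matrix \<open>S A\<close> only involves the eigenvalue 0 of \<open>Y\<close>, on which the exponential is 1.\<close>
  have ESA: "E t ** (S ** A) = S ** A" for t
  proof -
    have YSA: "Y ** (S ** A) = 0"
    proof -
      have "Y ** (S ** A) = T ** v ** (T ** S) ** A" by (simp add: Y_def matrix_mul_assoc)
      also have "\<dots> = T ** (v ** A)" by (simp add: ST matrix_mul_assoc)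
      finally show ?thesis by (simp add: vA)
    qed
    define Z where "Z = transpose W ** (S ** A)"
    have "diag_mat n ** Z = transpose W ** (Y ** (S ** A))"
      using W by (simp add: eigenframe_def Z_def matrix_mul_assoc cW)
    then have "diag_mat n ** Z = 0" by (simp add: YSA)
    then have nz: "n i * Z $ i $ j = 0" for i j by (metis diag_mat_mult_nth zero_index)
    have "diag_mat (\<lambda>i. exp (t * n i)) ** Z = Z"
    proof -
      have "exp (t * n i) * Z $ i $ j = Z $ i $ j" for i j using nz[of i j] by auto
      then show ?thesis by (simp add: vec_eq_iff diag_mat_mult_nth)
    qed
    then have "W ** (diag_mat (\<lambda>i. exp (t * n i)) ** Z) = W ** Z" by simp
    then show ?thesis by (simp add: E_def Z_def matrix_mul_assoc cW)
  qed
  have "c t \<in> action_fiber A B" for t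
  proof -
    have "c t \<in> spd" unfolding c_def
      by (rule spd_congruence[OF _ symS ST(1)]) (simp add: eigenframe_spd_iff[OF E])
    moreover have "det (c t) = det (S ** S)" by (simp add: c_def det_mul detE)
    moreover have "c t ** A = S ** (E t ** (S ** A))" by (simp add: c_def matrix_mul_assoc)
    then have "c t ** A = S ** S ** A" by (simp only: ESA) (simp add: matrix_mul_assoc)
    ultimately show ?thesis by (simp add: action_fiber_def spd1_def SS dP PA)
  qed
  moreover have "c 0 = P" by (simp add: c_def E_def diag_mat_const cW SS)
  moreover have "(c has_vector_derivative v) (at 0)"
  proof -
    have "((\<lambda>t. diag_mat (\<lambda>i. exp (t * n i))) has_vector_derivative diag_mat n) (at 0)"
      by (rule diag_mat_has_vector_derivative) (auto intro!: derivative_eq_intros)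
    then have "(E has_vector_derivative W ** diag_mat n ** transpose W) (at 0)"
      unfolding E_def[abs_def]
      by (intro bounded_linear.has_vector_derivative[OF matrix_mult.bounded_linear_left]
         bounded_linear.has_vector_derivative[OF matrix_mult.bounded_linear_right])
    then have "(c has_vector_derivative S ** Y ** S) (at 0)"
      using W unfolding c_def[abs_def] eigenframe_def
      by (intro bounded_linear.has_vector_derivative[OF matrix_mult.bounded_linear_left]
         bounded_linear.has_vector_derivative[OF matrix_mult.bounded_linear_right]) simp
    moreover have "S ** Y ** S = (S ** T) ** v ** (T ** S)" by (simp add: Y_def matrix_mul_assoc)
    ultimately show ?thesis by (simp add: ST)
  qed
  ultimately show ?thesis by (auto simp: curve_in_def)
qed

theorem tangent_at_action_fiber:
  fixes A :: "real^'m^'d"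
  assumes "P \<in> action_fiber A B"
  shows "tangent_at (action_fiber A B) P = fiber_tangent A P"
  using curve_velocity_in_fiber_tangent[OF assms] fiber_tangent_has_curve[OF assms] by (auto simp: tangent_at_def)

section \<open>Gradient and Hessian on action fibers\<close>

text \<open>For \<open>P A = B\<close> this is \<open>S (I - p) S\<^sup>-\<^sup>1\<close>, where \<open>S = P\<^sup>1\<^sup>/\<^sup>2\<close> and \<open>p\<close> is the orthogonal projection to the range of
\<open>S A\<close>. The square roots cancel, and so the matrix is the same at all points of the fiber.\<close>

definition fiber_projector :: "real^'m^'d \<Rightarrow> real^'m^'d \<Rightarrow> real^'d^'d" where
  "fiber_projector A B = mat 1 - B ** matrix_inv (transpose A ** B) ** transpose A"

text \<open>The Lagrange multiplier of the condition \<open>det P = 1\<close>.\<close>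

definition fiber_multiplier :: "real^'m^'d \<Rightarrow> real^'m^'d \<Rightarrow> real^'d^'d \<Rightarrow> real" where
  "fiber_multiplier A B P = trace (fiber_projector A B ** mat_log P) / (real CARD('d) - real CARD('m))"

definition fiber_gradient :: "real^'m^'d \<Rightarrow> real^'m^'d \<Rightarrow> real^'d^'d \<Rightarrow> real^'d^'d" where
  "fiber_gradient A B P = fiber_projector A B ** fun_calc xlnx P ** transpose (fiber_projector A B)
     - fiber_multiplier A B P *\<^sub>R (fiber_projector A B ** P)"

context
  fixes A B :: "real^'m^'d" and K P :: "real^'d^'d"
  assumes B: "B \<in> admissible_targets A" and P: "P \<in> action_fiber A B"
  defines "K \<equiv> fiber_projector A B"
begin

lemma fiber_point_spd: "P \<in> spd" and fiber_point_action: "P ** A = B"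
  using P by (auto simp: action_fiber_def spd1_def)

lemma gram_spd: "transpose A ** B \<in> spd" using B by (simp add: admissible_targets_def)

lemma transpose_target: "transpose B = transpose A ** P"
  using fiber_point_action spd_symmetric[OF fiber_point_spd] by (metis matrix_transpose_mul)

lemma gram_symmetric: "transpose B ** A = transpose A ** B"
  using spd_symmetric[OF gram_spd] by (simp add: matrix_transpose_mul)

lemma transpose_projector: "transpose K = mat 1 - A ** matrix_inv (transpose A ** B) ** transpose B"
  using matrix_inv_spd(3)[OF gram_spd] by (simp add: K_def fiber_projector_def transpose_diff matrix_transpose_mul matrix_mul_assoc)

lemma transpose_projector_annihilates: "transpose K ** A = 0"
proof -
  have "transpose K ** A = A - A ** (matrix_inv (transpose A ** B) ** (transpose B ** A))"
    by (simp add: transpose_projector matrix_mult.diff_left matrix_mul_assoc)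
  then show ?thesis by (simp add: gram_symmetric matrix_inv_spd(2)[OF gram_spd])
qed

text \<open>Self-adjointness of the projector with respect to \<open>P\<close>; it follows from \<open>P A = B\<close>.\<close>

lemma projector_commutes_point: "K ** P = P ** transpose K"
  unfolding transpose_projector unfolding K_def fiber_projector_def
  by (simp add: matrix_mult.diff_left matrix_mult.diff_right matrix_mul_assoc fiber_point_action transpose_target[symmetric]
      flip: matrix_mul_assoc[of _ "transpose A" P])

lemma projector_commutes_inverse: "transpose K ** matrix_inv P = matrix_inv P ** K"
proof -
  have "matrix_inv P ** (K ** P) ** matrix_inv P = matrix_inv P ** K"
    by (simp add: matrix_mul_assoc[symmetric] matrix_inv_spd[OF fiber_point_spd])
  moreover have "matrix_inv P ** (P ** transpose K) ** matrix_inv P = transpose K ** matrix_inv P"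
    by (simp add: matrix_mul_assoc matrix_inv_spd[OF fiber_point_spd])
  ultimately show ?thesis by (simp add: projector_commutes_point)
qed

lemma projector_idempotent: "K ** K = K"
proof -
  have "transpose K ** transpose K = transpose K"
    by (subst (2) transpose_projector) (simp add: matrix_mult.diff_right matrix_mul_assoc transpose_projector_annihilates)
  then show ?thesis by (metis matrix_transpose_mul transpose_transpose)
qed

text \<open>This is the rank of the projector, which has to be positive for the multiplier to be defined.\<close>

lemma trace_projector: "trace K = real CARD('d) - real CARD('m)"
proof -
  have "trace (B ** matrix_inv (transpose A ** B) ** transpose A) = trace (matrix_inv (transpose A ** B) ** (transpose A ** B))"
    using trace_mul_sym[of B "matrix_inv (transpose A ** B) ** transpose A"] by (simp add: matrix_mul_assoc)
  then show ?thesis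
    by (simp add: K_def fiber_projector_def trace_sub trace_I matrix_inv_spd(2)[OF gram_spd])
qed

lemma projector_fixes_tangent:
  assumes "v \<in> fiber_tangent A P"
  shows "v ** transpose K = v" "K ** v = v"
proof -
  have v: "transpose v = v" "v ** A = 0" using assms by (auto simp: fiber_tangent_def)
  show *: "v ** transpose K = v"
    by (simp add: transpose_projector matrix_mult.diff_right matrix_mul_assoc v(2))
  then have "transpose (v ** transpose K) = transpose v" by simp
  then show "K ** v = v" by (simp add: matrix_transpose_mul v)
qed

text \<open>Against tangent vectors the two-sided projection can be dropped, and \<open>K P\<close> is normal to the fiber.\<close>

lemma projector_adjoint_on_tangent:
  assumes w: "w \<in> fiber_tangent A P"
  shows "ai_metric P (K ** Z ** transpose K) w = ai_metric P Z w"
    "ai_metric P (K ** P) w = 0"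
proof -
  have "ai_metric P (K ** Z ** transpose K) w = trace (matrix_inv P ** K ** Z ** (transpose K ** matrix_inv P) ** w)"
    by (simp add: ai_metric_def matrix_mul_assoc)
  also have "\<dots> = trace (matrix_inv P ** K ** Z ** matrix_inv P ** (K ** w))"
    by (simp add: projector_commutes_inverse matrix_mul_assoc)
  also have "\<dots> = trace (transpose K ** (matrix_inv P ** Z ** matrix_inv P ** w))"
    by (simp add: projector_fixes_tangent[OF w] projector_commutes_inverse[symmetric] matrix_mul_assoc)
  also have "\<dots> = trace (matrix_inv P ** Z ** matrix_inv P ** (w ** transpose K))"
    by (subst trace_mul_sym) (simp add: matrix_mul_assoc)
  finally show "ai_metric P (K ** Z ** transpose K) w = ai_metric P Z w"
    by (simp add: projector_fixes_tangent[OF w] ai_metric_def)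
  have "ai_metric P (K ** P) w = trace (matrix_inv P ** K ** (P ** matrix_inv P) ** w)"
    by (simp add: ai_metric_def matrix_mul_assoc)
  also have "\<dots> = trace (matrix_inv P ** (K ** w))" by (simp add: matrix_inv_spd[OF fiber_point_spd] matrix_mul_assoc)
  finally show "ai_metric P (K ** P) w = 0" using w by (simp add: projector_fixes_tangent[OF w] fiber_tangent_def)
qed

lemma fiber_gradient_tangent:
  assumes card: "CARD('m) < CARD('d)"
  shows "fiber_gradient A B P \<in> fiber_tangent A P"
proof -
  let ?E = "fun_calc xlnx P" and ?G = "fiber_gradient A B P"
  have G: "?G = K ** ?E ** transpose K - fiber_multiplier A B P *\<^sub>R (K ** P)" by (simp add: fiber_gradient_def K_def)
  have symE: "transpose ?E = ?E"
    using spectral_theorem[OF spd_symmetric[OF fiber_point_spd]] eigenframe_fun_calc eigenframe_symmetric by metis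
  have "transpose ?G = ?G"
    by (simp add: G transpose_diff transpose_scalar matrix_transpose_mul symE matrix_mul_assoc
        spd_symmetric[OF fiber_point_spd] projector_commutes_point[symmetric])
  moreover have "?G ** A = 0"
  proof -
    have "K ** P ** A = P ** (transpose K ** A)" by (simp add: projector_commutes_point matrix_mul_assoc)
    moreover have "K ** ?E ** transpose K ** A = K ** ?E ** (transpose K ** A)" by (simp add: matrix_mul_assoc)
    ultimately show ?thesis by (simp add: G matrix_mult.diff_left matrix_mult.scaleR_left transpose_projector_annihilates)
  qed
  moreover have "trace (matrix_inv P ** ?G) = 0"
  proof -
    have "trace (matrix_inv P ** (K ** ?E ** transpose K)) = trace (transpose K ** (matrix_inv P ** K ** ?E))"
      by (subst trace_mul_sym) (simp add: matrix_mul_assoc)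
    also have "transpose K ** (matrix_inv P ** K ** ?E) = matrix_inv P ** (K ** K) ** ?E"
      by (simp add: projector_commutes_inverse matrix_mul_assoc)
    also have "\<dots> = transpose K ** (matrix_inv P ** P) ** mat_log P"
      by (simp add: projector_idempotent projector_commutes_inverse[symmetric] fun_calc_xlnx[OF fiber_point_spd] matrix_mul_assoc)
    also have "trace \<dots> = trace (transpose (mat_log P ** K))"
      by (simp add: matrix_inv_spd[OF fiber_point_spd] matrix_transpose_mul mat_log_symmetric[OF fiber_point_spd])
    also have "\<dots> = trace (mat_log P ** K)" by (simp add: trace_def transpose_def)
    also have "\<dots> = trace (K ** mat_log P)" by (rule trace_mul_sym)
    finally have 1: "trace (matrix_inv P ** (K ** ?E ** transpose K)) = trace (K ** mat_log P)" .
    have 2: "trace (matrix_inv P ** (K ** P)) = trace K"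
      by (subst trace_mul_sym) (simp add: matrix_mul_assoc[symmetric] matrix_inv_spd[OF fiber_point_spd])
    have "trace (matrix_inv P ** ?G) = trace (K ** mat_log P) - fiber_multiplier A B P * trace K"
      by (simp add: G matrix_mult.diff_right matrix_mult.scaleR_right trace_sub trace_scaleR 1 2)
    then show ?thesis using card by (simp add: fiber_multiplier_def trace_projector K_def[symmetric])
  qed
  ultimately show ?thesis by (simp add: fiber_tangent_def)
qed

lemma fiber_gradient_is_gradient:
  assumes card: "CARD('m) < CARD('d)"
  shows "is_gradient (action_fiber A B) fiber_objective P (fiber_gradient A B P)"
  unfolding is_gradient_def
proof (intro conjI allI impI)
  show "fiber_gradient A B P \<in> tangent_at (action_fiber A B) P"
    using fiber_gradient_tangent[OF card] tangent_at_action_fiber[OF P] by simp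
  fix v c assume c: "curve_in (action_fiber A B) P v c"
  have "\<forall>\<^sub>F t in nhds 0. c t \<in> action_fiber A B" using c by (simp add: curve_in_def)
  then have "\<forall>\<^sub>F t in nhds 0. c t \<in> spd" by eventually_elim (simp add: action_fiber_def spd1_def)
  then have "((\<lambda>t. fiber_objective (c t)) has_real_derivative ai_metric P (fun_calc xlnx P) v) (at 0)"
    using c by (intro fiber_objective_has_derivative[OF fiber_point_spd]) (auto simp: curve_in_def)
  moreover have "ai_metric P (fiber_gradient A B P) v = ai_metric P (fun_calc xlnx P) v"
    using projector_adjoint_on_tangent[OF curve_velocity_in_fiber_tangent[OF P c]]
    by (simp add: fiber_gradient_def ai_metric_diff_left ai_metric_scaleR_left K_def[symmetric])
  ultimately show "((\<lambda>t. fiber_objective (c t)) has_real_derivative ai_metric P (fiber_gradient A B P) v) (at 0)"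
    by simp
qed

text \<open>The multiplier contributes \<open>- \<mu> v\<close> to the derivative of the gradient and \<open>+ \<mu> v\<close> through the Christoffel term;
the derivative \<open>s\<close> of the multiplier only moves along the normal direction \<open>K P\<close>. What is left is the ambient
covariant derivative \<open>Z\<close>.\<close>

lemma fiber_covariant_derivative_tangent:
  assumes v: "v \<in> fiber_tangent A P" and w: "w \<in> fiber_tangent A P"
    and DE: "DE = Z + (1/2) *\<^sub>R (v ** mat_log P + mat_log P ** v)"
  shows "ai_metric P (ai_covariant P v (fiber_gradient A B P)
     (K ** DE ** transpose K - (s *\<^sub>R (K ** P) + fiber_multiplier A B P *\<^sub>R (K ** v)))) w = ai_metric P Z w"
proof -
  let ?E = "fun_calc xlnx P" and ?I = "matrix_inv P" and ?L = "mat_log P" and ?f = "fiber_multiplier A B P"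
  have G: "fiber_gradient A B P = K ** ?E ** transpose K - ?f *\<^sub>R (K ** P)"
    by (simp add: fiber_gradient_def K_def)
  have IE: "?I ** ?E = ?L"  by (simp add: fun_calc_xlnx(1)[OF fiber_point_spd] matrix_mul_assoc matrix_inv_spd[OF fiber_point_spd])
  have EI: "?E ** ?I = ?L"  by (simp add: fun_calc_xlnx(2)[OF fiber_point_spd] matrix_mul_assoc[symmetric] matrix_inv_spd[OF fiber_point_spd])
  have vIK: "v ** ?I ** K = v ** ?I"
    using projector_fixes_tangent[OF v] projector_commutes_inverse by (metis matrix_mul_assoc)
  have KIv: "transpose K ** ?I ** v = ?I ** v"
    using projector_fixes_tangent[OF v] projector_commutes_inverse by (metis matrix_mul_assoc)
  have "v ** ?I ** fiber_gradient A B P = v ** ?L ** transpose K - ?f *\<^sub>R v"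
  proof -
    have "v ** ?I ** (K ** ?E ** transpose K) = (v ** ?I ** K) ** ?E ** transpose K" by (simp add: matrix_mul_assoc)
    also have "\<dots> = v ** (?I ** ?E) ** transpose K" unfolding vIK by (simp add: matrix_mul_assoc)
    finally have 1: "v ** ?I ** (K ** ?E ** transpose K) = v ** ?L ** transpose K" by (simp add: IE)
    have "v ** ?I ** (K ** P) = v ** (?I ** P)" using vIK by (simp add: matrix_mul_assoc)
    then show ?thesis by (simp add: G matrix_mult.diff_right matrix_mult.scaleR_right 1 matrix_inv_spd[OF fiber_point_spd])
  qed
  moreover have "v ** ?L ** transpose K = K ** (v ** ?L) ** transpose K"
    by (simp add: matrix_mul_assoc projector_fixes_tangent[OF v])
  moreover have "fiber_gradient A B P ** ?I ** v = K ** ?L ** v - ?f *\<^sub>R v"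
  proof -
    have "K ** ?E ** transpose K ** ?I ** v = K ** ?E ** (transpose K ** ?I ** v)" by (simp add: matrix_mul_assoc)
    also have "\<dots> = K ** (?E ** ?I) ** v" unfolding KIv by (simp add: matrix_mul_assoc)
    finally have 1: "K ** ?E ** transpose K ** ?I ** v = K ** ?L ** v" by (simp add: EI)
    have "K ** P ** ?I ** v = K ** (P ** ?I) ** v" by (simp add: matrix_mul_assoc)
    then show ?thesis
      by (simp add: G matrix_mult.diff_left matrix_mult.scaleR_left 1 matrix_inv_spd[OF fiber_point_spd] projector_fixes_tangent[OF v])
  qed
  moreover have "K ** ?L ** v = K ** (?L ** v) ** transpose K"
    using projector_fixes_tangent[OF v] by (simp add: matrix_mul_assoc[symmetric])
  moreover have "K ** DE ** transpose K = K ** Z ** transpose K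
     + (1/2) *\<^sub>R (K ** (v ** ?L) ** transpose K + K ** (?L ** v) ** transpose K)"
    by (simp add: DE matrix_mult.add_left matrix_mult.add_right matrix_mult.scaleR_left matrix_mult.scaleR_right)
  ultimately have "ai_covariant P v (fiber_gradient A B P)
     (K ** DE ** transpose K - (s *\<^sub>R (K ** P) + ?f *\<^sub>R (K ** v))) = K ** Z ** transpose K - s *\<^sub>R (K ** P)"
    by (simp only: ai_covariant_def projector_fixes_tangent[OF v] half_sum_cancel)
  then show ?thesis
    by (simp add: ai_metric_diff_left ai_metric_scaleR_left projector_adjoint_on_tangent[OF w])
qed

end

theorem fiber_has_hessian:
  fixes A B :: "real^'m^'d" and U :: "real^'d^'d"
  assumes card: "CARD('m) < CARD('d)" and B: "B \<in> admissible_targets A" and P: "P \<in> action_fiber A B"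
    and U: "eigenframe U l P" and l: "\<And>i. l i > 0"
  shows "has_hessian (action_fiber A B) fiber_objective P
     (\<lambda>v w. ai_metric P (schur_frame U (\<lambda>i j. psi ((ln (l i) - ln (l j)) / 2)) v) w)"
  unfolding has_hessian_def
proof (intro exI[of _ "fiber_gradient A B"] conjI ballI allI impI)
  fix R assume "R \<in> action_fiber A B"
  then show "is_gradient (action_fiber A B) fiber_objective R (fiber_gradient A B R)"
    by (rule fiber_gradient_is_gradient[OF B _ card])
next
  fix v c assume cv: "curve_in (action_fiber A B) P v c"
  then have c: "(c has_vector_derivative v) (at 0)" "c 0 = P" by (auto simp: curve_in_def)
  have "\<forall>\<^sub>F t in nhds 0. c t \<in> action_fiber A B" using cv by (simp add: curve_in_def)
  then have spd: "\<forall>\<^sub>F t in nhds 0. c t \<in> spd" by eventually_elim (simp add: action_fiber_def spd1_def)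
  define K where "K = fiber_projector A B"
  define Z where "Z = schur_frame U (\<lambda>i j. psi ((ln (l i) - ln (l j)) / 2)) v"
  define DE where "DE = Z + (1/2) *\<^sub>R (v ** mat_log P + mat_log P ** v)"
  define DL where "DL = schur_frame U (\<lambda>i j. divided_difference ln inverse (l j) (l i)) v"
  \<comment> \<open>The derivative of the multiplier along the curve.\<close>
  define s where "s = trace (K ** DL) / (real CARD('d) - real CARD('m))"
  define DG where "DG = K ** DE ** transpose K - (s *\<^sub>R (K ** P) + fiber_multiplier A B P *\<^sub>R (K ** v))"
  have dE: "((\<lambda>t. fun_calc xlnx (c t)) has_vector_derivative DE) (at 0)"
    unfolding DE_def Z_def by (rule ambient_gradient_derivative[OF U l c spd])
  have dL: "((\<lambda>t. mat_log (c t)) has_vector_derivative DL) (at 0)"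
    unfolding DL_def by (rule mat_log_has_vector_derivative[OF U l c spd])
  have ds: "((\<lambda>t. fiber_multiplier A B (c t)) has_vector_derivative s) (at 0)"
    unfolding fiber_multiplier_def K_def[symmetric] s_def
    by (intro bounded_linear.has_vector_derivative[OF bounded_linear_divide]
      bounded_linear.has_vector_derivative[OF bounded_linear_trace]
      bounded_linear.has_vector_derivative[OF matrix_mult.bounded_linear_right] dL)
  have dG: "((\<lambda>t. fiber_gradient A B (c t)) has_vector_derivative DG) (at 0)"
  proof -
    have 1: "((\<lambda>t. K ** fun_calc xlnx (c t) ** transpose K) has_vector_derivative K ** DE ** transpose K) (at 0)"
      by (intro bounded_linear.has_vector_derivative[OF matrix_mult.bounded_linear_left]
         bounded_linear.has_vector_derivative[OF matrix_mult.bounded_linear_right] dE)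
    have 2: "((\<lambda>t. K ** c t) has_vector_derivative K ** v) (at 0)"
      by (intro bounded_linear.has_vector_derivative[OF matrix_mult.bounded_linear_right] c)
    have "((\<lambda>t. fiber_multiplier A B (c t) *\<^sub>R (K ** c t)) has_vector_derivative
       (fiber_multiplier A B (c 0) *\<^sub>R (K ** v) + s *\<^sub>R (K ** c 0))) (at 0)"
      by (rule bounded_bilinear.has_vector_derivative[OF bounded_bilinear_scaleR ds 2])
    from has_vector_derivative_diff[OF 1 this] show ?thesis
      by (simp add: fiber_gradient_def[abs_def] K_def[symmetric] DG_def c(2) add.commute)
  qed
  show "\<exists>DG. ((\<lambda>t. fiber_gradient A B (c t)) has_vector_derivative DG) (at 0) \<and>
     (\<forall>w\<in>tangent_at (action_fiber A B) P. ai_metric P Z w = ai_metric P (ai_covariant P v (fiber_gradient A B P) DG) w)"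
  proof (intro exI[of _ DG] conjI ballI dG)
    fix w assume "w \<in> tangent_at (action_fiber A B) P"
    then have w: "w \<in> fiber_tangent A P" by (simp add: tangent_at_action_fiber[OF P])
    show "ai_metric P Z w = ai_metric P (ai_covariant P v (fiber_gradient A B P) DG) w"
      unfolding DG_def K_def
      by (rule fiber_covariant_derivative_tangent[OF B P curve_velocity_in_fiber_tangent[OF P cv] w DE_def, symmetric])
  qed
qed

text \<open>The gradient is unique at each point of the fiber, so two Hessians differentiate the same field along a curve
in the fiber.\<close>

lemma has_hessian_unique:
  fixes A B :: "real^'m^'d"
  assumes P: "P \<in> action_fiber A B"
    and H: "has_hessian (action_fiber A B) f P H" and H': "has_hessian (action_fiber A B) f P H'"
    and v: "v \<in> tangent_at (action_fiber A B) P" and w: "w \<in> tangent_at (action_fiber A B) P"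
  shows "H v w = H' v w"
proof -
  let ?N = "action_fiber A B"
  have uniq: "G1 = G2" if R: "R \<in> ?N" and g: "is_gradient ?N f R G1" "is_gradient ?N f R G2" for R G1 G2
  proof -
    have t: "G1 \<in> fiber_tangent A R" "G2 \<in> fiber_tangent A R"
      using g tangent_at_action_fiber[OF R] by (auto simp: is_gradient_def)
    then have d: "G1 - G2 \<in> fiber_tangent A R"
      by (auto simp: fiber_tangent_def transpose_diff matrix_mult.diff_left matrix_mult.diff_right trace_sub)
    obtain c where c: "curve_in ?N R (G1 - G2) c" using fiber_tangent_has_curve[OF R d] by blast
    have "ai_metric R G1 (G1 - G2) = ai_metric R G2 (G1 - G2)"
      using g c unfolding is_gradient_def by (metis DERIV_unique)
    then have "ai_metric R (G1 - G2) (G1 - G2) = 0" by (simp add: ai_metric_diff_left)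
    moreover have "R \<in> spd" using R by (simp add: action_fiber_def spd1_def)
    ultimately show ?thesis using ai_metric_definite[of R "G1 - G2"] d by (simp add: fiber_tangent_def)
  qed
  obtain c where c: "curve_in ?N P v c" using v by (auto simp: tangent_at_def)
  obtain G where G: "\<forall>R\<in>?N. is_gradient ?N f R (G R)"
    and G': "\<exists>DG. ((\<lambda>t. G (c t)) has_vector_derivative DG) (at 0) \<and> H v w = ai_metric P (ai_covariant P v (G P) DG) w"
    using H c w unfolding has_hessian_def by meson
  obtain J where J: "\<forall>R\<in>?N. is_gradient ?N f R (J R)"
    and J': "\<exists>DG. ((\<lambda>t. J (c t)) has_vector_derivative DG) (at 0) \<and> H' v w = ai_metric P (ai_covariant P v (J P) DG) w"
    using H' c w unfolding has_hessian_def by meson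
  have GJ: "G R = J R" if "R \<in> ?N" for R using uniq G J that by blast
  obtain D D' where D: "((\<lambda>t. G (c t)) has_vector_derivative D) (at 0)" "H v w = ai_metric P (ai_covariant P v (G P) D) w"
    and D': "((\<lambda>t. J (c t)) has_vector_derivative D') (at 0)" "H' v w = ai_metric P (ai_covariant P v (J P) D') w"
    using G' J' by blast
  have "D - D' = 0"
  proof (rule const_on_nhds_derivative)
    show "((\<lambda>t. G (c t) - J (c t)) has_vector_derivative D - D') (at 0)"
      by (intro has_vector_derivative_diff D D')
    have "\<forall>\<^sub>F t in nhds 0. c t \<in> ?N" using c by (simp add: curve_in_def)
    then show "\<forall>\<^sub>F t in nhds 0. G (c t) - J (c t) = 0" by eventually_elim (simp add: GJ)
  qed
  then show ?thesis using D D' GJ[OF P] by simp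
qed

theorem fiber_hessian_majorant:
  assumes card: "CARD('m::finite) < CARD('d::finite)"
  shows "hessian_majorant TYPE('d) TYPE('m) D (psi (D / sqrt 2))"
  unfolding hessian_majorant_def
proof (intro allI impI)
  fix A B :: "real^'m^'d" and P :: "real^'d^'d"
  assume B: "B \<in> admissible_targets A" and P: "P \<in> action_fiber A B" and D: "ai_dist (mat 1) P \<le> D"
  have "P \<in> spd" using P by (simp add: action_fiber_def spd1_def)
  then obtain U :: "real^'d^'d" and l where U: "eigenframe U l P" and l: "\<And>i. l i > 0"
    using spd_eigenframe by blast
  show "\<exists>H. has_hessian (action_fiber A B) fiber_objective P H \<and>
      (\<forall>v\<in>tangent_at (action_fiber A B) P. H v v \<le> psi (D / sqrt 2) * ai_metric P v v)"
  proof (intro exI conjI ballI)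
    show "has_hessian (action_fiber A B) fiber_objective P
     (\<lambda>v w. ai_metric P (schur_frame U (\<lambda>i j. psi ((ln (l i) - ln (l j)) / 2)) v) w)"
      by (rule fiber_has_hessian[OF card B P U l])
    fix v assume "v \<in> tangent_at (action_fiber A B) P"
    then have "transpose v = v" by (simp add: tangent_at_action_fiber[OF P] fiber_tangent_def)
    then show "ai_metric P (schur_frame U (\<lambda>i j. psi ((ln (l i) - ln (l j)) / 2)) v) v
       \<le> psi (D / sqrt 2) * ai_metric P v v"
      by (rule ambient_hessian_bound[OF U l _ D])
  qed
qed

section \<open>Fibers through the identity\<close>

lemma mat_one_spd: "(mat 1 :: real^'d^'d) \<in> spd"
  using eigenframe_spd_iff[OF eigenframe_one[of "mat 1 :: real^'d^'d"]]
  by (simp add: orthonormal_frame_def)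

lemma mat_log_one: "mat_log (mat 1 :: real^'d^'d) = 0"
  using mat_log_eigenframe[OF eigenframe_one[of "mat 1 :: real^'d^'d"]]
  by (simp add: orthonormal_frame_def diag_mat_const)

lemma mat_log_eq_0_imp:
  assumes "P \<in> spd" "mat_log P = 0" shows "P = mat 1"
proof -
  obtain U :: "real^'a^'a" and l where U: "eigenframe U l P" and l: "\<And>i. l i > 0"
    using spd_eigenframe[OF assms(1)] by blast
  have "norm (mat_log P) = 0" using assms by simp
  then have "(\<Sum>i\<in>UNIV. (ln (l i))\<^sup>2) = 0"
    unfolding mat_log_eigenframe[OF U l] norm_conj_diag[OF eigenframe_frame[OF U]] by simp
  then have "ln (l i) = 0" for i by (subst (asm) sum_nonneg_eq_0_iff) auto
  then have "l = (\<lambda>_. 1)" using l by (auto simp: ln_eq_zero_iff)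
  then show ?thesis using U by (simp add: eigenframe_def diag_mat_const frame_cancel)
qed

lemma self_fiber_canonical_controller: "is_canonical_controller A A (mat 1)"
  unfolding is_canonical_controller_def
proof (intro conjI ballI impI)
  show "mat 1 \<in> action_fiber A A" by (simp add: action_fiber_def spd1_def mat_one_spd)
  fix P assume P: "P \<in> action_fiber A A" "P \<noteq> mat 1"
  then have "mat_log P \<noteq> 0" using mat_log_eq_0_imp by (auto simp: action_fiber_def spd1_def)
  then show "fiber_objective (mat 1) < fiber_objective P"
    by (simp add: fiber_objective_def ai_dist_one mat_log_one)
qed

lemma canonical_controller_eqI:
  assumes "is_canonical_controller A B S"
  shows "canonical_controller A B = S"
  unfolding canonical_controller_def
proof (rule the_equality[where P = "is_canonical_controller A B", OF assms])
  fix R assume R: "is_canonical_controller A B R"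
  show "R = S"
  proof (rule ccontr)
    assume "R \<noteq> S"
    then have "fiber_objective R < fiber_objective S" "fiber_objective S < fiber_objective R"
      using R assms by (auto simp: is_canonical_controller_def)
    then show False by simp
  qed
qed

section \<open>Residuals in the reduced chart\<close>

lemma sum_UNIV_sum: "sum f (UNIV :: ('m::finite + 'n::finite) set) = (\<Sum>i\<in>UNIV. f (Inl i)) + (\<Sum>i\<in>UNIV. f (Inr i))"
  using sum.Plus[of "UNIV :: 'm set" "UNIV :: 'n set" f] by (simp add: UNIV_Plus_UNIV)

text \<open>Splits an equation between block matrices into four equations between blocks.\<close>

lemma vec_sum_eq_iff:
  "(X :: real^('m::finite+'n::finite)^('m+'n)) = Y \<longleftrightarrow>
    (\<forall>i j. X$Inl i$Inl j = Y$Inl i$Inl j) \<and> (\<forall>i j. X$Inl i$Inr j = Y$Inl i$Inr j)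
  \<and> (\<forall>i j. X$Inr i$Inl j = Y$Inr i$Inl j) \<and> (\<forall>i j. X$Inr i$Inr j = Y$Inr i$Inr j)"
  by (simp add: vec_eq_iff split_sum_all) blast

lemma block_mat_mult:
  "block_mat X Y Z W ** block_mat X' Y' Z' W' =
    block_mat (X ** X' + Y ** Z') (X ** Y' + Y ** W') (Z ** X' + W ** Z') (Z ** Y' + W ** W')"
  unfolding vec_sum_eq_iff by (simp add: block_mat_def matrix_matrix_mult_def sum_UNIV_sum)

lemma transpose_block_mat:
  "transpose (block_mat X Y Z W) = block_mat (transpose X) (transpose Z) (transpose Y) (transpose W)"
  unfolding vec_sum_eq_iff by (simp add: block_mat_def transpose_def)

lemma block_mat_one: "block_mat (mat 1) 0 0 (mat 1) = mat 1"
  unfolding vec_sum_eq_iff by (simp add: block_mat_def mat_def)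

lemma diag_mat_case_sum: "diag_mat (case_sum a b) = block_mat (diag_mat a) 0 0 (diag_mat b)"
  unfolding vec_sum_eq_iff by (simp add: block_mat_def diag_mat_def)

lemma lower_right_block_mat: "lower_right (block_mat X Y Z W) = W"
  by (simp add: lower_right_def block_mat_def vec_eq_iff)

lemma eigenframe_block_mat:
  assumes W: "eigenframe W m S"
  shows "eigenframe (block_mat (mat 1) 0 0 W) (case_sum (\<lambda>_. 1) m) (block_mat (mat 1) 0 0 S)"
  using W unfolding eigenframe_def orthonormal_frame_def diag_mat_case_sum
  by (simp add: transpose_block_mat block_mat_mult block_mat_one diag_mat_const frame_cancel)

lemma left_columns_gram:
  assumes "transpose Q ** Q = mat 1"
  shows "transpose (left_columns Q) ** left_columns Q = mat 1"
    "transpose (right_columns Q) ** left_columns Q = 0"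
proof -
  have "(transpose Q ** Q) $ Inl i $ Inl j = (transpose (left_columns Q) ** left_columns Q) $ i $ j" for i j
    by (simp add: matrix_matrix_mult_def transpose_def left_columns_def)
  then show "transpose (left_columns Q) ** left_columns Q = mat 1"
    using assms by (simp add: vec_eq_iff mat_def)
  have "(transpose Q ** Q) $ Inr i $ Inl j = (transpose (right_columns Q) ** left_columns Q) $ i $ j" for i j
    by (simp add: matrix_matrix_mult_def transpose_def left_columns_def right_columns_def)
  then show "transpose (right_columns Q) ** left_columns Q = 0"
    using assms by (simp add: vec_eq_iff mat_def)
qed

context
  fixes A :: "real^'m^'d" and Q :: "real^('m::finite + 'n::finite)^'d" and C :: "real^'m^'m"
  assumes frame: "fiber_frame A Q C"
begin

lemma fiber_frame_orthonormal: "orthonormal_frame Q" using frame by (simp add: fiber_frame_def orthonormal_frame_def)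

lemma fiber_frame_inverse: "C ** matrix_inv C = mat 1" "matrix_inv C ** C = mat 1"
proof -
  obtain D where "C ** D = mat 1" using frame by (auto simp: fiber_frame_def invertible_def)
  then show "C ** matrix_inv C = mat 1" using matrix_inv_eqI by metis
  then show "matrix_inv C ** C = mat 1" using matrix_left_right_inverse by blast
qed

lemma fiber_frame_factor: "A = left_columns Q ** C" using frame by (simp add: fiber_frame_def)

lemma fiber_frame_left_columns: "A ** matrix_inv C = left_columns Q"
  by (simp add: fiber_frame_factor matrix_mul_assoc[symmetric] fiber_frame_inverse)

lemma self_fiber_M: "fiber_M A C A = mat 1"
proof -
  have "fiber_M A C A = transpose (A ** matrix_inv C) ** (A ** matrix_inv C)"
    by (simp add: fiber_M_def matrix_transpose_mul matrix_mul_assoc)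
  then show ?thesis using fiber_frame_orthonormal by (simp add: fiber_frame_left_columns left_columns_gram orthonormal_frame_def)
qed

lemma self_fiber_L: "fiber_L A Q C A = mat 1"
proof -
  have "fiber_N Q C A = transpose (right_columns Q) ** (A ** matrix_inv C)"
    by (simp add: fiber_N_def matrix_mul_assoc)
  then have "fiber_N Q C A = 0" using fiber_frame_orthonormal by (simp add: fiber_frame_left_columns left_columns_gram orthonormal_frame_def)
  then show ?thesis by (simp add: fiber_L_def fiber_T_def block_mat_one)
qed

lemma self_fiber_core: "fiber_core A C A S = block_mat (mat 1) 0 0 S"
  by (simp add: fiber_core_def self_fiber_M)

lemma self_fiber_R0: "fiber_R0 A Q C A = mat 1"
proof -
  have "matrix_inv (mat 1 :: real^('m+'n)^('m+'n)) = mat 1" by (rule matrix_inv_eqI) simp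
  then show ?thesis by (simp add: fiber_R0_def self_fiber_L)
qed

lemma self_fiber_Phi: "fiber_Phi A Q C A S = Q ** block_mat (mat 1) 0 0 S ** transpose Q"
  by (simp add: fiber_Phi_def self_fiber_L self_fiber_core)

text \<open>In the frame \<open>Q\<close> the equation \<open>P A = A\<close> says that the columns of the first block are those of the identity; by
symmetry the rows are as well.\<close>

lemma self_fiber_chart:
  assumes P: "P \<in> action_fiber A A"
  obtains S where "fiber_Phi A Q C A S = P" "transpose S = S"
proof -
  define X where "X = transpose Q ** P ** Q"
  have symP: "transpose P = P" and PA: "P ** A = A" using P by (auto simp: action_fiber_def spd1_def spd_symmetric)
  have symX: "transpose X = X" by (simp add: X_def matrix_transpose_mul matrix_mul_assoc symP)
  have swap: "X $ p $ q = X $ q $ p" for p q using arg_cong[OF symX, of "\<lambda>M. M $ q $ p"] by (simp add: transpose_def)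
  have "P ** left_columns Q = left_columns Q"
    by (simp add: fiber_frame_left_columns[symmetric] matrix_mul_assoc PA)
  then have "transpose Q ** P ** left_columns Q = transpose Q ** left_columns Q"
    by (simp add: matrix_mul_assoc[symmetric])
  moreover have "(Y ** Q) $ q $ Inl j = (Y ** left_columns Q) $ q $ j" for Y :: "real^'d^('m+'n)" and q j
    by (simp add: matrix_matrix_mult_def left_columns_def)
  ultimately have "X $ q $ Inl j = (transpose Q ** Q) $ q $ Inl j" for q j
    by (simp add: X_def)
  then have col: "X $ q $ Inl j = (mat 1 :: real^('m+'n)^('m+'n)) $ q $ Inl j" for q j
    by (simp add: frame_cancel[OF fiber_frame_orthonormal])
  have X: "X = block_mat (mat 1) 0 0 (lower_right X)"
    unfolding vec_sum_eq_iff using col swap[of "Inl _" "Inr _"] by (simp add: block_mat_def lower_right_def mat_def)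
  have "fiber_Phi A Q C A (lower_right X) = Q ** X ** transpose Q"
    using X by (simp add: self_fiber_Phi)
  also have "\<dots> = P" by (simp add: X_def matrix_mul_assoc frame_cancel[OF fiber_frame_orthonormal])
  finally show ?thesis
    using that[of "lower_right X"] swap by (simp add: transpose_def lower_right_def vec_eq_iff)
qed

text \<open>A diagonalisation of \<open>S\<close> extends to one of the core and, through \<open>Q\<close>, to one of \<open>P\<close>, with additional eigenvalues
equal to 1. The distance, the norm of the corrected block and the reduced objective then involve
the same sum of squared logarithms, and \<open>det S = 1\<close> makes the correction vanish.\<close>

theorem self_fiber_posterior_equalities:
  assumes P: "P \<in> action_fiber A A"
  shows "\<exists>S\<in>spd1. fiber_Phi A Q C A S = P \<and> ai_dist P (mat 1) = norm (fiber_W A Q C A S) \<and>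
     reduced_objective A Q C A S - reduced_objective A Q C A (mat 1) = (1/2) * (norm (fiber_W A Q C A S))\<^sup>2"
proof -
  obtain S where S: "fiber_Phi A Q C A S = P" "transpose S = S" using self_fiber_chart[OF P] .
  obtain W :: "real^'n^'n" and m where W: "eigenframe W m S" using spectral_theorem[OF S(2)] .
  define O1 where "O1 = block_mat (mat 1 :: real^'m^'m) 0 0 W"
  define n where "n = case_sum (\<lambda>_::'m. 1) m"
  have core: "eigenframe O1 n (fiber_core A C A S)"
    unfolding self_fiber_core O1_def n_def by (rule eigenframe_block_mat[OF W])
  have eP: "eigenframe (Q ** O1) n P"
    using core frame_mult[OF fiber_frame_orthonormal eigenframe_frame[OF core]] S(1)
    by (simp add: eigenframe_def self_fiber_Phi self_fiber_core matrix_transpose_mul matrix_mul_assoc)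
  have spdP: "P \<in> spd" and detP: "det P = 1" using P by (auto simp: action_fiber_def spd1_def)
  have n: "n i > 0" for i using spdP eigenframe_spd_iff[OF eP] by blast
  have m: "m i > 0" for i using n[of "Inr i"] by (simp add: n_def)
  have "det P = det S"
    unfolding det_eigenframe[OF eP n] det_eigenframe[OF W m] by (simp add: n_def sum_UNIV_sum)
  then have dS: "det S = 1" and S1: "S \<in> spd1"
    using detP m eigenframe_spd_iff[OF W] by (auto simp: spd1_def)
  have sum0: "(\<Sum>i\<in>UNIV. ln (m i)) = 0" using dS det_eigenframe[OF W m] by simp
  have resid: "fiber_residual A Q C A S = block_mat 0 0 0 (W ** diag_mat (\<lambda>i. - ln (m i)) ** transpose W)"
  proof -
    have "(\<lambda>i. - ln (n i)) = case_sum (\<lambda>_. 0) (\<lambda>i. - ln (m i))" by (auto simp: n_def split: sum.split)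
    then show ?thesis
      unfolding fiber_residual_def self_fiber_R0 log_whitened_one_eigenframe[OF core n]
      by (simp add: O1_def diag_mat_case_sum transpose_block_mat block_mat_mult diag_mat_const)
  qed
  have "fiber_W A Q C A S = W ** diag_mat (\<lambda>i. - ln (m i)) ** transpose W"
    by (simp add: fiber_W_def resid lower_right_block_mat frame_trace[OF eigenframe_frame[OF W]]
       trace_diag_mat sum_negf sum0)
  then have nW: "norm (fiber_W A Q C A S) = sqrt (\<Sum>i\<in>UNIV. (ln (m i))\<^sup>2)"
    by (simp add: norm_conj_diag[OF eigenframe_frame[OF W]])
  have sums: "(\<Sum>i\<in>UNIV. (ln (n i))\<^sup>2) = (\<Sum>i\<in>UNIV. (ln (m i))\<^sup>2)" by (simp add: n_def sum_UNIV_sum)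
  have "ai_dist P (mat 1) = norm (fiber_W A Q C A S)"
    unfolding ai_dist_def log_whitened_one_eigenframe[OF eP n] norm_conj_diag[OF eigenframe_frame[OF eP]] nW
    by (simp add: sums)
  moreover have "reduced_objective A Q C A S = (1/2) * (norm (fiber_W A Q C A S))\<^sup>2"
    unfolding reduced_objective_def self_fiber_R0 ai_dist_one mat_log_eigenframe[OF core n]
      norm_conj_diag[OF eigenframe_frame[OF core]] nW by (simp add: sums)
  moreover have "reduced_objective A Q C A (mat 1) = 0"
    by (simp add: reduced_objective_def self_fiber_R0 self_fiber_core block_mat_one ai_dist_one mat_log_one)
  ultimately show ?thesis using S S1 by auto
qed

lemma self_fiber_Phi_one: "fiber_Phi A Q C A (mat 1) = mat 1"
  by (simp add: self_fiber_Phi block_mat_one frame_cancel[OF fiber_frame_orthonormal])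

end

section \<open>The fiber of the first unit vector\<close>

lemma e1_nth: "e1 $ i $ j = (if i = 1 then 1 else 0)"
  by (simp add: e1_def columnvector_def axis_def)

lemma e1_gram: "transpose e1 ** e1 = mat 1"
  by (simp add: vec_eq_iff matrix_matrix_mult_def transpose_def e1_nth mat_def sum_3)

lemma mult_e1: "(P ** e1) $ i $ j = P $ i $ 1"
  by (simp add: matrix_matrix_mult_def e1_nth sum_3)

lemma e1_admissible: "e1 \<in> admissible_targets e1"
  by (simp add: admissible_targets_def e1_gram mat_one_spd)

lemma rank_e1: "rank e1 = CARD(1)"
  unfolding full_rank_injective
proof (rule injI)
  fix x y :: "real^1" assume "e1 *v x = e1 *v y"
  then have "(e1 *v x) $ 1 = (e1 *v y) $ 1" by simp
  then show "x = y" by (simp add: matrix_vector_mult_def e1_nth vec_eq_iff)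
qed

text \<open>Reduces positivity of the block matrix to positivity of the lower block.\<close>

lemma diag1_quadratic: "x \<bullet> (diag1 S *v x) = (x $ 1)\<^sup>2 + vector [x $ 2, x $ 3] \<bullet> (S *v vector [x $ 2, x $ 3])"
  by (simp add: inner_vec_def matrix_vector_mult_def sum_3 sum_2 diag1_def power2_eq_square algebra_simps)

lemma diag1_spd_iff: "diag1 S \<in> spd \<longleftrightarrow> S \<in> spd"
proof -
  have "transpose (diag1 S) = diag1 S \<longleftrightarrow> transpose S = S"
    by (auto simp: transpose_def vec_eq_iff forall_3 forall_2 diag1_def)
  moreover have "(\<forall>x. x \<noteq> 0 \<longrightarrow> x \<bullet> (diag1 S *v x) > 0) \<longleftrightarrow> (\<forall>y. y \<noteq> 0 \<longrightarrow> y \<bullet> (S *v y) > 0)"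
  proof (intro iffI allI impI)
    fix y :: "real^2" assume *: "\<forall>x. x \<noteq> 0 \<longrightarrow> x \<bullet> (diag1 S *v x) > 0" and y: "y \<noteq> 0"
    define x :: "real^3" where "x = vector [0, y $ 1, y $ 2]"
    have "x \<noteq> 0" using y by (auto simp: x_def vec_eq_iff forall_3 forall_2)
    then have "0 < x \<bullet> (diag1 S *v x)" using * by blast
    moreover have "vector [x $ 2, x $ 3] = y" by (simp add: x_def vec_eq_iff forall_2)
    ultimately show "y \<bullet> (S *v y) > 0" by (simp add: diag1_quadratic) (simp add: x_def)
  next
    fix x :: "real^3" assume *: "\<forall>y. y \<noteq> 0 \<longrightarrow> y \<bullet> (S *v y) > 0" and x: "x \<noteq> 0"
    define y :: "real^2" where "y = vector [x $ 2, x $ 3]"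
    show "x \<bullet> (diag1 S *v x) > 0"
    proof (cases "y = 0")
      case True
      then have "x $ 1 \<noteq> 0" using x by (auto simp: y_def vec_eq_iff forall_3 forall_2)
      then show ?thesis using True by (simp add: diag1_quadratic y_def[symmetric])
    next
      case False
      then show ?thesis using * by (simp add: diag1_quadratic y_def[symmetric] add_nonneg_pos)
    qed
  qed
  ultimately show ?thesis by (simp add: spd_def)
qed

lemma det_diag1: "det (diag1 S) = det S"
  by (simp add: det_3 det_2 diag1_def)

lemma action_fiber_e1: "action_fiber e1 e1 = {diag1 S | S. S \<in> spd1}"
proof (intro equalityI subsetI)
  fix P assume P: "P \<in> action_fiber e1 e1"
  have sym: "P $ i $ j = P $ j $ i" for i j
  proof -
    have "transpose P = P" using P by (simp add: action_fiber_def spd1_def spd_symmetric)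
    from arg_cong[OF this, of "\<lambda>M. M $ j $ i"] show ?thesis by (simp add: transpose_def)
  qed
  have "P $ i $ 1 = e1 $ i $ 1" for i
    using P mult_e1[of P i 1] by (simp add: action_fiber_def)
  then have col: "P $ i $ 1 = (if i = 1 then 1 else 0)" for i by (simp add: e1_nth)
  define S :: "real^2^2" where "S = vector [vector [P $ 2 $ 2, P $ 2 $ 3], vector [P $ 3 $ 2, P $ 3 $ 3]]"
  have "P = diag1 S"
    using col sym[of 1 2] sym[of 1 3] by (simp add: vec_eq_iff forall_3 diag1_def S_def)
  moreover have "S \<in> spd1" using P calculation
    by (simp add: action_fiber_def spd1_def diag1_spd_iff det_diag1)
  ultimately show "P \<in> {diag1 S | S. S \<in> spd1}" by blast
next
  fix P assume "P \<in> {diag1 S | S. S \<in> spd1}"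
  then obtain S where S: "P = diag1 S" "S \<in> spd1" by blast
  have "P ** e1 = e1"
    by (simp add: vec_eq_iff forall_3 mult_e1 e1_nth S diag1_def)
  then show "P \<in> action_fiber e1 e1" using S
    by (simp add: action_fiber_def spd1_def diag1_spd_iff det_diag1)
qed

definition triple :: "real \<Rightarrow> real \<Rightarrow> real \<Rightarrow> 3 \<Rightarrow> real" where
  "triple a b c i = (if i = 1 then a else if i = 2 then b else c)"

lemma triple_simps [simp]: "triple a b c 1 = a" "triple a b c 2 = b" "triple a b c 3 = c"
  by (simp_all add: triple_def)

lemma eigenframe_diag_mat: "eigenframe (mat 1) l (diag_mat l)"
  by (simp add: eigenframe_def orthonormal_frame_def)

lemma prod_UNIV_3: "prod f (UNIV :: 3 set) = f 1 * f 2 * f 3"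
  unfolding UNIV_3 by (simp add: mult.assoc)

lemma exp_diag_in_fiber_e1: "diag_mat (triple 1 (exp x) (exp (- x))) \<in> action_fiber e1 e1" (is "?P \<in> _")
proof -
  have "?P \<in> spd" unfolding eigenframe_spd_iff[OF eigenframe_diag_mat] by (simp add: triple_def)
  moreover have "det ?P = 1" by (simp add: det_diag_mat prod_UNIV_3 exp_minus)
  moreover have "?P ** e1 = e1" by (simp add: vec_eq_iff forall_3 mult_e1 e1_nth diag_mat_def)
  ultimately show ?thesis by (simp add: action_fiber_def spd1_def)
qed

lemma hessian_attains_psi:
  assumes D: "D > 0"
  obtains P v H where "P \<in> action_fiber e1 e1" "ai_dist (mat 1) P = D"
    "v \<in> tangent_at (action_fiber e1 e1) P" "ai_metric P v v = 1"
    "has_hessian (action_fiber e1 e1) fiber_objective P H" "H v v = psi (D / sqrt 2)"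
proof -
  define x where "x = D / sqrt 2"
  define l where "l = triple 1 (exp x) (exp (- x))"
  define P where "P = diag_mat l"
  have l: "l i > 0" for i by (simp add: l_def triple_def)
  have l0: "l i \<noteq> 0" for i using l[of i] by simp
  have U: "eigenframe (mat 1) l P" unfolding P_def by (rule eigenframe_diag_mat)
  have P: "P \<in> action_fiber e1 e1" unfolding P_def l_def by (rule exp_diag_in_fiber_e1)
  have dist: "ai_dist (mat 1) P = D"
  proof -
    have "ai_dist (mat 1) P = sqrt (x\<^sup>2 + x\<^sup>2)"
      unfolding ai_dist_one mat_log_eigenframe[OF U l] norm_conj_diag[OF eigenframe_frame[OF U]]
      by (simp add: sum_3 l_def)
    also have "x\<^sup>2 + x\<^sup>2 = D\<^sup>2" by (simp add: x_def power_divide)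
    finally show ?thesis using D by simp
  qed
  \<comment> \<open>Mixing the second and third eigendirection selects the factor \<open>psi\<close> of the two extreme eigenvalues; the
    whitening factors \<open>e\<^sup>x\<close> and \<open>e\<^sup>-\<^sup>x\<close> cancel, so the Frobenius norm 1 is also the metric norm.\<close>
  define v :: "real^3^3" where "v = (\<chi> i j. if (i = 2 \<and> j = 3) \<or> (i = 3 \<and> j = 2) then 1 / sqrt 2 else 0)"
  have symv: "transpose v = v" by (auto simp: v_def transpose_def vec_eq_iff)
  have "v ** e1 = 0" by (simp add: vec_eq_iff mult_e1 v_def)
  moreover have "trace (matrix_inv P ** v) = 0"
    using matrix_inv_eigenframe[OF U l0] by (simp add: eigenframe_def trace_def diag_mat_mult_nth v_def sum_3)
  ultimately have tan: "v \<in> tangent_at (action_fiber e1 e1) P"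
    using symv by (simp add: tangent_at_action_fiber[OF P] fiber_tangent_def)
  have unit: "ai_metric P v v = 1"
    unfolding ai_metric_self_eigenframe[OF U l0 symv]
    by (simp add: sum_3 v_def l_def power_divide exp_minus)
  have "ai_metric P (schur_frame (mat 1) (\<lambda>i j. psi ((ln (l i) - ln (l j)) / 2)) v) v = psi x"
    unfolding schur_frame_metric[OF U l symv]
    using psi_minus[of x] by (simp add: sum_3 v_def l_def power_divide flip: exp_add)
  moreover have "has_hessian (action_fiber e1 e1) fiber_objective P
     (\<lambda>v w. ai_metric P (schur_frame (mat 1) (\<lambda>i j. psi ((ln (l i) - ln (l j)) / 2)) v) w)"
    by (rule fiber_has_hessian[OF _ e1_admissible P U l]) simp
  ultimately show ?thesis using that[OF P dist tan unit] by (simp add: x_def)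
qed

text \<open>The constant bounds some Hessian at the extremal point, and uniqueness identifies it with the one computed
there.\<close>

lemma majorant_lower_bound:
  assumes D: "D > 0" and maj: "hessian_majorant TYPE(3) TYPE(1) D c"
  shows "psi (D / sqrt 2) \<le> c"
proof -
  obtain P v H where P: "P \<in> action_fiber e1 e1" and dist: "ai_dist (mat 1) P = D"
    and v: "v \<in> tangent_at (action_fiber e1 e1) P" and unit: "ai_metric P v v = 1"
    and H: "has_hessian (action_fiber e1 e1) fiber_objective P H" "H v v = psi (D / sqrt 2)"
    using hessian_attains_psi[OF D] .
  obtain H' where H': "has_hessian (action_fiber e1 e1) fiber_objective P H'"
      "H' v v \<le> c * ai_metric P v v"
    using maj rank_e1 e1_admissible P dist v unfolding hessian_majorant_def by (metis order_refl)
  show ?thesis using has_hessian_unique[OF P H(1) H'(1) v v] H'(2) H(2) unit by simp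
qed

text \<open>The curve \<open>t \<mapsto> diag(1, exp(t / sqrt 2), exp(- t / sqrt 2))\<close>: its covariant acceleration in the
whole cone already vanishes.\<close>

lemma radial_geodesic_exists:
  "\<exists>v\<in>tangent_at (action_fiber e1 e1) (mat 1). \<exists>g. ai_metric (mat 1) v v = 1 \<and>
      geodesic_from (action_fiber e1 e1) (mat 1) v g"
proof -
  define a where "a = triple 0 (1 / sqrt 2) (- 1 / sqrt 2)"
  \<comment> \<open>\<open>g k\<close> is the \<open>k\<close>-th derivative of the curve.\<close>
  define g where "g k t = diag_mat (\<lambda>i. a i ^ k * exp (t * a i))" for k :: nat and t :: real
  have deriv: "(g k has_vector_derivative g (Suc k) t) (at t)" for k t
    unfolding g_def[abs_def]
    by (rule diag_mat_has_vector_derivative) (auto intro!: derivative_eq_intros)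
  have g0: "g 0 0 = mat 1" by (simp add: g_def diag_mat_const)
  have fib: "g 0 t \<in> action_fiber e1 e1" for t
  proof -
    have "(\<lambda>i. exp (t * a i)) = triple 1 (exp (t / sqrt 2)) (exp (- (t / sqrt 2)))"
      by (auto simp: a_def triple_def)
    then show ?thesis using exp_diag_in_fiber_e1[of "t / sqrt 2"] by (simp add: g_def)
  qed
  have "curve_in (action_fiber e1 e1) (mat 1) (g 1 0) (g 0)"
    using deriv[of 0 0] fib by (simp add: curve_in_def g0)
  then have tan: "g 1 0 \<in> tangent_at (action_fiber e1 e1) (mat 1)" by (auto simp: tangent_at_def)
  have inv1: "matrix_inv (mat 1 :: real^3^3) = mat 1" by (rule matrix_inv_eqI) simp
  have "ai_metric (mat 1) (g 1 0) (g 1 0) = 1"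
    by (simp add: ai_metric_def inv1 g_def diag_mat_mult trace_diag_mat sum_3 a_def)
  moreover have "ai_covariant (g 0 t) (g 1 t) (g 1 t) (g 2 t) = 0" for t
  proof -
    have "matrix_inv (g 0 t) = diag_mat (\<lambda>i. inverse (exp (t * a i)))"
      using matrix_inv_eigenframe[OF eigenframe_diag_mat, of "\<lambda>i. exp (t * a i)"]
      by (simp add: eigenframe_def g_def)
    then have "g 1 t ** matrix_inv (g 0 t) ** g 1 t = g 2 t"
      by (simp add: g_def diag_mat_mult power2_eq_square mult.assoc mult.left_commute)
    then show ?thesis by (simp add: ai_covariant_def)
  qed
  then have "geodesic_from (action_fiber e1 e1) (mat 1) (g 1 0) (g 0)"
    unfolding geodesic_from_def using deriv[of 0] deriv[of 1] fib g0
    by (intro conjI allI, simp, simp, rule_tac exI[of _ "g 1"], rule_tac exI[of _ "g 2"])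
      (simp add: ai_metric_def numeral_2_eq_2 trace_def)
  ultimately show ?thesis using tan by blast
qed

theorem proposition1:
  shows "action_fiber e1 e1 = {diag1 \<Sigma> | \<Sigma>. \<Sigma> \<in> spd1}
    \<and> is_canonical_controller e1 e1 (mat 1)
    \<and> (\<forall>D>0. \<exists>P\<in>action_fiber e1 e1. ai_dist (mat 1) P = D \<and>
         (\<exists>v\<in>tangent_at (action_fiber e1 e1) P. ai_metric P v v = 1 \<and>
           (\<exists>H. has_hessian (action_fiber e1 e1) fiber_objective P H \<and>
                H v v = psi (D / sqrt 2))))
    \<and> (CARD('m::finite) < CARD('d::finite) \<longrightarrow>
         (\<forall>D>0. hessian_majorant TYPE('d) TYPE('m) D (psi (D / sqrt 2))))
    \<and> (\<forall>D>0. \<forall>c. hessian_majorant TYPE(3) TYPE(1) D c \<longrightarrow> psi (D / sqrt 2) \<le> c)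
    \<and> (\<exists>v\<in>tangent_at (action_fiber e1 e1) (canonical_controller e1 e1).
         \<exists>\<gamma>. ai_metric (canonical_controller e1 e1) v v = 1 \<and>
             geodesic_from (action_fiber e1 e1) (canonical_controller e1 e1) v \<gamma>)
    \<and> (\<forall>(Q :: real^(1 + 2)^3) C v \<gamma>. fiber_frame e1 Q C \<longrightarrow>
         ai_metric (canonical_controller e1 e1) v v = 1 \<longrightarrow>
         geodesic_from (action_fiber e1 e1) (canonical_controller e1 e1) v \<gamma> \<longrightarrow>
         (\<exists>\<Sigma>\<^sub>s\<in>spd1. fiber_Phi e1 Q C e1 \<Sigma>\<^sub>s = canonical_controller e1 e1 \<and>
           (\<forall>t. \<exists>\<Sigma>\<in>spd1. fiber_Phi e1 Q C e1 \<Sigma> = \<gamma> t \<and>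
              ai_dist (fiber_Phi e1 Q C e1 \<Sigma>) (canonical_controller e1 e1)
                = norm (fiber_W e1 Q C e1 \<Sigma>) \<and>
              reduced_objective e1 Q C e1 \<Sigma> - reduced_objective e1 Q C e1 \<Sigma>\<^sub>s
                = (1/2) * (norm (fiber_W e1 Q C e1 \<Sigma>))\<^sup>2)))"
proof -
  have can: "is_canonical_controller e1 e1 (mat 1)" by (rule self_fiber_canonical_controller)
  note ctrl = canonical_controller_eqI[OF can]
  show ?thesis unfolding ctrl
  proof (intro conjI allI impI)
    fix D :: real assume "D > 0"
    then show "\<exists>P\<in>action_fiber e1 e1. ai_dist (mat 1) P = D \<and>
         (\<exists>v\<in>tangent_at (action_fiber e1 e1) P. ai_metric P v v = 1 \<and>
           (\<exists>H. has_hessian (action_fiber e1 e1) fiber_objective P H \<and> H v v = psi (D / sqrt 2)))"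
      by (rule hessian_attains_psi) blast
  next
    fix Q :: "real^(1 + 2)^3" and C v \<gamma>
    assume fr: "fiber_frame e1 Q C" and g: "geodesic_from (action_fiber e1 e1) (mat 1) v \<gamma>"
    have g': "\<gamma> t \<in> action_fiber e1 e1" for t using g by (simp add: geodesic_from_def)
    show "\<exists>\<Sigma>\<^sub>s\<in>spd1. fiber_Phi e1 Q C e1 \<Sigma>\<^sub>s = mat 1 \<and>
           (\<forall>t. \<exists>\<Sigma>\<in>spd1. fiber_Phi e1 Q C e1 \<Sigma> = \<gamma> t \<and>
              ai_dist (fiber_Phi e1 Q C e1 \<Sigma>) (mat 1) = norm (fiber_W e1 Q C e1 \<Sigma>) \<and>
              reduced_objective e1 Q C e1 \<Sigma> - reduced_objective e1 Q C e1 \<Sigma>\<^sub>s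
                = (1/2) * (norm (fiber_W e1 Q C e1 \<Sigma>))\<^sup>2)"
    proof (rule bexI[of _ "mat 1"], intro conjI allI)
      show "fiber_Phi e1 Q C e1 (mat 1) = mat 1" by (rule self_fiber_Phi_one[OF fr])
      show "mat 1 \<in> spd1" by (simp add: spd1_def mat_one_spd)
      fix t
      show "\<exists>\<Sigma>\<in>spd1. fiber_Phi e1 Q C e1 \<Sigma> = \<gamma> t \<and>
              ai_dist (fiber_Phi e1 Q C e1 \<Sigma>) (mat 1) = norm (fiber_W e1 Q C e1 \<Sigma>) \<and>
              reduced_objective e1 Q C e1 \<Sigma> - reduced_objective e1 Q C e1 (mat 1)
                = (1/2) * (norm (fiber_W e1 Q C e1 \<Sigma>))\<^sup>2"
        using self_fiber_posterior_equalities[OF fr g'[of t]] by metis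
    qed
  qed (use action_fiber_e1 can fiber_hessian_majorant majorant_lower_bound radial_geodesic_exists in blast)+
qed

end
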